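(* Let $n\ge 2$ be an integer. Then $$\operatorname{ML-degree}(C_{2n+1})\ \ge\ 1+2^{2n}\cdot \bigl|\{x\in\mathbb{C}: P_{n-1}(x)+xP_{n-2}(x)=0\}\bigr|,$$ and $$\operatorname{ML-degree}(C_{2n})\ \ge\ 1+2^{2n-2}\cdot \bigl|\{x\in\mathbb{C}: P_{n-1}(x)-x^2P_{n-3}(x)=0\}\bigr|+2^{2n-2}\cdot \bigl|\{x\in\mathbb{C}: P_{n-2}(x)=0\}\bigr|+2^{2n-2}.$$ In particular, for every integer $n\ge 4$ we have $\operatorname{ML-degree}(C_n)>1$.
   Context: Let $G=(V,E)$ be a finite simple undirected graph with $N$ vertices $V=[N]=\{1,\dots,N\}$. Let $S^2(\mathbb{C}^N)$ be the space of complex symmetric $N\times N$ matrices. $L_G\subset S^2(\mathbb{C}^N)$ is the linear space of symmetric matrices $M$ with $M_{ij}=0$ whenever $i\neq j$ and $\{i,j\}\notin E$. $L_G^{-1}$ is the closure in $S^2(\mathbb{C}^N)$ of the set of inverses of invertible matrices in $L_G$. $L_G^{\perp}$ is the orthogonal complement of $L_G$ with respect to the bilinear trace form, i.e. the symmetric matrices that vanish on the diagonal and at all positions $(i,j)$ with $\{i,j\}\in E$. The ML-degree of $G$ is the number of points of $(S+L_G^{\perp})\cap L_G^{-1}$ for a generic symmetric matrix $S\in S^2(\mathbb{C}^N)$ (this number does not depend on the generic choice of $S$). $C_N$ denotes the cycle graph with $N$ vertices. For $k\ge 1$, $M_k(x)$ is the $k\times k$ tridiagonal matrix with all diagonal entries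 equal to $1$ and all entries on the superdiagonal and subdiagonal equal to $x$, and $P_k(x):=\det(M_k(x))$. By convention $P_0(x)=1$ and $P_{-1}(x)=0$ (consistent with the recurrence $P_k=P_{k-1}-x^2P_{k-2}$). *)

theory Defs
  imports "Jordan_Normal_Form.Determinant" "HOL-Computational_Algebra.Polynomial" Complex_Main
begin

(* A graph on N vertices is given by its set E of edges, each an unordered pair of vertices.
   The vertices are {0,...,N-1} rather than {1,...,N}, to agree with the indexing of matrices. *)

definition cycle_graph :: "nat \<Rightarrow> nat set set" where
  "cycle_graph N = {{i, (i + 1) mod N} | i. i < N}"

definition sym_mats :: "nat \<Rightarrow> complex mat set" where
  "sym_mats N = {M \<in> carrier_mat N N. transpose_mat M = M}"

definition L_space :: "nat \<Rightarrow> nat set set \<Rightarrow> complex mat set" where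
  "L_space N E =
     {M \<in> sym_mats N. \<forall>i<N. \<forall>j<N. i \<noteq> j \<and> {i, j} \<notin> E \<longrightarrow> M $$ (i, j) = 0}"

definition L_perp :: "nat \<Rightarrow> nat set set \<Rightarrow> complex mat set" where
  "L_perp N E = {M \<in> sym_mats N. \<forall>A \<in> L_space N E. (\<Sum>i<N. (A * M) $$ (i, i)) = 0}"

inductive matrix_polynomial :: "nat \<Rightarrow> (complex mat \<Rightarrow> complex) \<Rightarrow> bool" for N :: nat where
  const: "matrix_polynomial N (\<lambda>M. c)"
| entry: "i < N \<Longrightarrow> j < N \<Longrightarrow> matrix_polynomial N (\<lambda>M. M $$ (i, j))"
| add: "matrix_polynomial N f \<Longrightarrow> matrix_polynomial N g \<Longrightarrow> matrix_polynomial N (\<lambda>M. f M + g M)"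
| mult: "matrix_polynomial N f \<Longrightarrow> matrix_polynomial N g \<Longrightarrow> matrix_polynomial N (\<lambda>M. f M * g M)"

(* Closure in the Zariski topology. For the constructible set of inverses to which it is applied
   below, it coincides with the closure in the Euclidean topology. *)
definition zariski_closure :: "nat \<Rightarrow> complex mat set \<Rightarrow> complex mat set" where
  "zariski_closure N X =
     {M \<in> sym_mats N. \<forall>f. matrix_polynomial N f \<and> (\<forall>A\<in>X. f A = 0) \<longrightarrow> f M = 0}"

definition L_inv :: "nat \<Rightarrow> nat set set \<Rightarrow> complex mat set" where
  "L_inv N E = zariski_closure N
     {B \<in> carrier_mat N N. \<exists>A \<in> L_space N E. inverts_mat A B \<and> inverts_mat B A}"

(* Q holds on a nonempty Zariski open subset of the space of symmetric matrices: every such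
   subset contains one of the form {S. f S \<noteq> 0}. *)
definition for_generic :: "nat \<Rightarrow> (complex mat \<Rightarrow> bool) \<Rightarrow> bool" where
  "for_generic N Q \<longleftrightarrow>
     (\<exists>f. matrix_polynomial N f \<and> (\<exists>S \<in> sym_mats N. f S \<noteq> 0)
        \<and> (\<forall>S \<in> sym_mats N. f S \<noteq> 0 \<longrightarrow> Q S))"

(* The ML-degree is given as a relation; has_ML_degree_unique shows that the graph determines d. *)
definition has_ML_degree :: "nat \<Rightarrow> nat set set \<Rightarrow> nat \<Rightarrow> bool" where
  "has_ML_degree N E d \<longleftrightarrow>
     for_generic N (\<lambda>S. finite ({S + A | A. A \<in> L_perp N E} \<inter> L_inv N E)
                      \<and> card ({S + A | A. A \<in> L_perp N E} \<inter> L_inv N E) = d)"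

definition tridiag :: "nat \<Rightarrow> complex \<Rightarrow> complex mat" where
  "tridiag k x = mat k k (\<lambda>(i, j). if i = j then 1 else if i = j + 1 \<or> j = i + 1 then x else 0)"

(* The index is an integer because of the convention P (-1) = 0. P 0 = 1 is the determinant of
   the empty matrix. *)
definition P :: "int \<Rightarrow> complex \<Rightarrow> complex" where
  "P k x = (if k < 0 then 0 else det (tridiag (nat k) x))"

lemma matrix_polynomial_on_line:
  assumes "matrix_polynomial N f"
  shows "\<exists>p. \<forall>t. f (mat N N (\<lambda>(i, j). a i j + t * b i j)) = poly p t"
  using assms
proof induction
  case (const c)
  show ?case by (rule exI[of _ "[:c:]"]) simp
next
  case (entry i j)
  then show ?case by (intro exI[of _ "[:a i j, b i j:]"]) simp
next
  case (add f g)
  then obtain p q where "\<forall>t. f (mat N N (\<lambda>(i, j). a i j + t * b i j)) = poly p t"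
    "\<forall>t. g (mat N N (\<lambda>(i, j). a i j + t * b i j)) = poly q t" by blast
  then show ?case by (intro exI[of _ "p + q"]) simp
next
  case (mult f g)
  then obtain p q where "\<forall>t. f (mat N N (\<lambda>(i, j). a i j + t * b i j)) = poly p t"
    "\<forall>t. g (mat N N (\<lambda>(i, j). a i j + t * b i j)) = poly q t" by blast
  then show ?case by (intro exI[of _ "p * q"]) simp
qed

lemma sym_mats_iff:
  "M \<in> sym_mats N \<longleftrightarrow> M \<in> carrier_mat N N \<and> (\<forall>i<N. \<forall>j<N. M $$ (i, j) = M $$ (j, i))"
proof
  assume M: "M \<in> sym_mats N"
  then have c: "M \<in> carrier_mat N N" and t: "transpose_mat M = M" by (auto simp: sym_mats_def)
  have "M $$ (i, j) = M $$ (j, i)" if "i < N" "j < N" for i j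
    using arg_cong[OF t, of "\<lambda>X. X $$ (i, j)"] that c by simp
  with c show "M \<in> carrier_mat N N \<and> (\<forall>i<N. \<forall>j<N. M $$ (i, j) = M $$ (j, i))" by blast
qed (auto simp: sym_mats_def intro!: eq_matI)

lemma for_generic_conj:
  assumes "for_generic N Q" "for_generic N R"
  shows "\<exists>S \<in> sym_mats N. Q S \<and> R S"
proof -
  obtain f A where f: "matrix_polynomial N f" "A \<in> sym_mats N" "f A \<noteq> 0"
    "\<forall>S \<in> sym_mats N. f S \<noteq> 0 \<longrightarrow> Q S"
    using assms(1) unfolding for_generic_def by blast
  obtain g B where g: "matrix_polynomial N g" "B \<in> sym_mats N" "g B \<noteq> 0"
    "\<forall>S \<in> sym_mats N. g S \<noteq> 0 \<longrightarrow> R S"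
    using assms(2) unfolding for_generic_def by blast
  define l where
    "l t = mat N N (\<lambda>(i, j). A $$ (i, j) + t * (B $$ (i, j) - A $$ (i, j)))" for t
  have l0: "l 0 = A" and l1: "l 1 = B"
    using f(2) g(2) by (auto simp: l_def sym_mats_iff intro!: eq_matI)
  obtain p where p: "\<And>t. f (l t) = poly p t"
    using matrix_polynomial_on_line[OF f(1), where a = "\<lambda>i j. A $$ (i, j)"
        and b = "\<lambda>i j. B $$ (i, j) - A $$ (i, j)"] unfolding l_def by blast
  obtain q where q: "\<And>t. g (l t) = poly q t"
    using matrix_polynomial_on_line[OF g(1), where a = "\<lambda>i j. A $$ (i, j)"
        and b = "\<lambda>i j. B $$ (i, j) - A $$ (i, j)"] unfolding l_def by blast
  have "p \<noteq> 0" "q \<noteq> 0" using p[of 0] q[of 1] l0 l1 f(3) g(3) by auto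
  then have "finite {t. poly (p * q) t = 0}" by (intro poly_roots_finite) simp
  then have "{t. poly (p * q) t = 0} \<noteq> UNIV"
    using infinite_UNIV_char_0[where ?'a = complex] by metis
  then obtain t where "poly (p * q) t \<noteq> 0" by blast
  moreover have "l t \<in> sym_mats N" using f(2) g(2) by (auto simp: l_def sym_mats_iff)
  ultimately show ?thesis using p[of t] q[of t] f(4) g(4) by (auto intro!: bexI[of _ "l t"])
qed

lemma has_ML_degree_unique:
  assumes "has_ML_degree N E d" "has_ML_degree N E d'"
  shows "d = d'"
  using for_generic_conj[OF assms[unfolded has_ML_degree_def]] by blast

end

theory Submission
  imports "HOL-Complex_Analysis.Conformal_Mappings" Defs
begin

text \<open>
  All three bounds follow from the uniform bound \<open>1 + (N - 3) * 2 ^ (N - 2)\<close> for the \<open>N\<close>-cycle, since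
  the degrees of the polynomials limit the numbers of their roots.

  Inverses of matrices in \<open>L_G\<close> for a cycle are semiseparable:
  \<open>X\<^sub>i\<^sub>j = \<mu> a\<^sub>i b\<^sub>j + \<nu> b\<^sub>i a\<^sub>j\<close> for \<open>i \<le> j\<close>, and conversely every such matrix lies in \<open>L_G\<^sup>-\<^sup>1\<close>.
  With \<open>\<mu> + \<nu> = 1\<close> the diagonal conditions give \<open>a\<^sub>i b\<^sub>i = S\<^sub>i\<^sub>i\<close>, each edge of a spanning path gives a
  quadratic equation for \<open>a\<^sub>i\<^sub>+\<^sub>1 / a\<^sub>i\<close>, and the remaining edge gives one equation in the one
  unknown \<open>\<mu>\<close>. At \<open>S = 1\<close> the solutions other than \<open>X = 1\<close> correspond to the
  \<open>2 (N - 2)\<close>-th roots of unity \<open>z \<noteq> \<plusminus>1\<close>, with \<open>\<nu> = 1 / (1 - z\<^sup>2)\<close>, together with a choice of signs,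
  which makes \<open>(N - 3) * 2 ^ (N - 2)\<close> distinct points. As isolated zeros of holomorphic functions of one
  variable persist under perturbation, they all survive for generic \<open>S\<close> near \<open>1\<close>.
\<close>

section \<open>Counting roots\<close>

text \<open>Laplace expansion along the first row; the minor \<open>B\<close> of the off-diagonal
  entry has at most its top entry nonzero in its first column, so a second expansion ends at
  \<open>tridiag k x\<close>.\<close>

lemma det_tridiag_Suc_Suc:
  "det (tridiag (Suc (Suc k)) x) = det (tridiag (Suc k) x) - x\<^sup>2 * det (tridiag k x)"
proof -
  let ?A = "tridiag (Suc (Suc k)) x"
  define B where "B = mat_delete ?A 0 1"
  have A: "?A \<in> carrier_mat (Suc (Suc k)) (Suc (Suc k))" by (simp add: tridiag_def)
  have B: "B \<in> carrier_mat (Suc k) (Suc k)" by (simp add: B_def tridiag_def mat_delete_def)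
  have del: "mat_delete ?A 0 0 = tridiag (Suc k) x"
    by (rule eq_matI) (auto simp: tridiag_def mat_delete_def)
  have del2: "mat_delete B 0 0 = tridiag k x"
    by (rule eq_matI) (auto simp: B_def tridiag_def mat_delete_def)
  have "det B = (\<Sum>i<Suc k. B $$ (i, 0) * cofactor B i 0)"
    by (rule laplace_expansion_column[OF B]) simp
  also have "\<dots> = (\<Sum>i\<in>{0}. B $$ (i, 0) * cofactor B i 0)"
    by (rule sum.mono_neutral_right) (auto simp: B_def tridiag_def mat_delete_def)
  also have "\<dots> = x * det (tridiag k x)"
    by (simp add: cofactor_def del2) (simp add: B_def tridiag_def mat_delete_def)
  finally have detB: "det B = x * det (tridiag k x)" .
  have "det ?A = (\<Sum>j<Suc (Suc k). ?A $$ (0, j) * cofactor ?A 0 j)"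
    by (rule laplace_expansion_row[OF A]) simp
  also have "\<dots> = (\<Sum>j\<in>{0, 1}. ?A $$ (0, j) * cofactor ?A 0 j)"
    by (rule sum.mono_neutral_right) (auto simp: tridiag_def)
  also have "\<dots> = det (tridiag (Suc k) x) - x * det B"
    by (simp add: cofactor_def del B_def[symmetric, simplified]) (simp add: tridiag_def)
  finally show ?thesis by (simp add: detB power2_eq_square)
qed

text \<open>The values of \<open>P\<close> at nonnegative indices as formal polynomials, so that
  degrees can bound numbers of roots.\<close>

fun tridiag_poly :: "nat \<Rightarrow> complex poly" where
  "tridiag_poly 0 = 1"
| "tridiag_poly (Suc 0) = 1"
| "tridiag_poly (Suc (Suc k)) = tridiag_poly (Suc k) - monom 1 2 * tridiag_poly k"

lemma poly_tridiag_poly: "poly (tridiag_poly k) x = P (int k) x"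
proof (induction k rule: tridiag_poly.induct)
  case 1
  show ?case by (simp add: P_def tridiag_def)
next
  case 2
  have "tridiag (Suc 0) x = 1\<^sub>m (Suc 0)" by (rule eq_matI) (auto simp: tridiag_def)
  then show ?case by (simp add: P_def)
next
  case (3 k)
  then show ?case by (simp add: P_def nat_add_distrib det_tridiag_Suc_Suc poly_monom flip: of_nat_Suc)
qed

text \<open>The recurrence raises the degree by at most 2 whenever the index rises by 2. Rounding
  down to an even number is what makes the sum in \<open>card_roots_even\<close> small
  enough.\<close>

lemma degree_tridiag_poly: "degree (tridiag_poly k) \<le> 2 * (k div 2)"
proof (induction k rule: tridiag_poly.induct)
  case (3 k)
  have "degree (monom 1 2 * tridiag_poly k) \<le> 2 + 2 * (k div 2)"
    using degree_mult_le[of "monom 1 2" "tridiag_poly k"] 3(2) by (simp add: degree_monom_eq)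
  moreover have "degree (tridiag_poly (Suc k)) \<le> 2 + 2 * (k div 2)" using 3(1) by linarith
  ultimately show ?case by (simp add: degree_diff_le)
qed auto

lemma poly_tridiag_poly_0 [simp]: "poly (tridiag_poly k) 0 = 1"
  by (induction k rule: tridiag_poly.induct) (auto simp: poly_monom)

text \<open>The value 1 at 0 certifies that the polynomial is not zero.\<close>

lemma card_roots_le_degree:
  fixes p :: "complex poly"
  assumes "poly p 0 = 1" "degree p \<le> k"
  shows "card {x. poly p x = 0} \<le> k"
  using card_poly_roots_bound[of p] assms by fastforce

lemma card_roots_odd:
  assumes "n \<ge> 2"
  shows "card {x. P (int n - 1) x + x * P (int n - 2) x = 0} \<le> n - 1"
proof -
  obtain m where n: "n = Suc (Suc m)" using assms by (metis add_2_eq_Suc le_Suc_ex)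
  let ?p = "tridiag_poly (Suc m) + monom 1 1 * tridiag_poly m"
  have "degree (monom 1 1 * tridiag_poly m) \<le> 1 + degree (tridiag_poly m)"
    using degree_mult_le[of "monom 1 1" "tridiag_poly m"] by (simp add: degree_monom_eq)
  then have "degree ?p \<le> n - 1"
    using degree_tridiag_poly[of m] degree_tridiag_poly[of "Suc m"]
    by (intro degree_add_le) (auto simp: n)
  then have "card {x. poly ?p x = 0} \<le> n - 1"
    by (intro card_roots_le_degree) (auto simp: poly_monom)
  then show ?thesis by (simp add: n poly_tridiag_poly poly_monom)
qed

lemma card_roots_even:
  assumes "n \<ge> 2"
  shows "card {x. P (int n - 1) x - x\<^sup>2 * P (int n - 3) x = 0} + card {x. P (int n - 2) x = 0}
    \<le> 2 * n - 4"
proof -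
  obtain m where n: "n = Suc (Suc m)" using assms by (metis add_2_eq_Suc le_Suc_ex)
  \<comment> \<open>For \<open>m = 0\<close> the index \<open>int n - 3\<close> is -1, where
    \<open>P\<close> vanishes by convention, while the truncated \<open>m - 1\<close> would give the
    polynomial 1.\<close>
  let ?p = "tridiag_poly (Suc m) - (if m = 0 then 0 else monom 1 2 * tridiag_poly (m - 1))"
  have "degree (monom 1 2 * tridiag_poly (m - 1)) \<le> 2 + degree (tridiag_poly (m - 1))"
    using degree_mult_le[of "monom 1 2" "tridiag_poly (m - 1)"] by (simp add: degree_monom_eq)
  moreover have "2 + 2 * ((m - 1) div 2) \<le> 2 * (Suc m div 2)" if "m \<noteq> 0" using that by presburger
  ultimately have "degree ?p \<le> 2 * (Suc m div 2)"
    using degree_tridiag_poly[of "m - 1"] degree_tridiag_poly[of "Suc m"]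
    by (intro degree_diff_le) auto
  then have "card {x. poly ?p x = 0} \<le> 2 * (Suc m div 2)"
    by (intro card_roots_le_degree) (auto simp: poly_monom)
  moreover have "poly ?p x = P (int n - 1) x - x\<^sup>2 * P (int n - 3) x" for x
  proof (cases m)
    case 0
    then show ?thesis by (simp add: n P_def tridiag_def flip: poly_tridiag_poly[of 1, simplified])
  next
    case (Suc l)
    then show ?thesis by (simp add: n poly_tridiag_poly poly_monom del: tridiag_poly.simps)
  qed
  moreover have "card {x. poly (tridiag_poly m) x = 0} \<le> 2 * (m div 2)"
    by (intro card_roots_le_degree) (auto simp: degree_tridiag_poly)
  ultimately have "card {x. P (int n - 1) x - x\<^sup>2 * P (int n - 3) x = 0} + card {x. P (int n - 2) x = 0}
    \<le> 2 * (Suc m div 2) + 2 * (m div 2)"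
    by (simp add: n poly_tridiag_poly)
  \<comment> \<open>Exactly one of the consecutive numbers \<open>m\<close> and \<open>Suc m\<close>
    is odd, so the two halves add up to \<open>m\<close>.\<close>
  also have "\<dots> = 2 * n - 4" unfolding n by presburger
  finally show ?thesis .
qed

section \<open>Semiseparable matrices\<close>

definition semisep_mat :: "nat \<Rightarrow> complex \<Rightarrow> complex \<Rightarrow> (nat \<Rightarrow> complex) \<Rightarrow> (nat \<Rightarrow> complex) \<Rightarrow> complex mat"
  where "semisep_mat N \<mu> \<nu> a b =
    mat N N (\<lambda>(i, j). \<mu> * a (min i j) * b (max i j) + \<nu> * b (min i j) * a (max i j))"

lemma semisep_mat_sym: "semisep_mat N \<mu> \<nu> a b \<in> sym_mats N"
  by (auto simp: sym_mats_iff semisep_mat_def min.commute max.commute)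

lemma semisep_mat_index:
  "i \<le> j \<Longrightarrow> j < N \<Longrightarrow> semisep_mat N \<mu> \<nu> a b $$ (i, j) = \<mu> * a i * b j + \<nu> * b i * a j"
  by (simp add: semisep_mat_def)

lemma semisep_mat_index':
  "j \<le> i \<Longrightarrow> i < N \<Longrightarrow> semisep_mat N \<mu> \<nu> a b $$ (i, j) = \<mu> * a j * b i + \<nu> * b j * a i"
  by (simp add: semisep_mat_def)

section \<open>Neighbours in the cycle and the explicit inverse of a semiseparable matrix\<close>

definition cyc_next :: "nat \<Rightarrow> nat \<Rightarrow> nat" where "cyc_next N i = (if Suc i = N then 0 else Suc i)"
definition cyc_prev :: "nat \<Rightarrow> nat \<Rightarrow> nat" where "cyc_prev N i = (if i = 0 then N - 1 else i - 1)"

lemma cycle_graph_alt: "cycle_graph N = {{i, cyc_next N i} | i. i < N}"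
proof -
  have "(i + 1) mod N = cyc_next N i" if "i < N" for i using that by (auto simp: cyc_next_def)
  then show ?thesis unfolding cycle_graph_def by (metis (no_types, lifting))
qed

lemma cyc_simps:
  assumes "N \<ge> 3" "i < N"
  shows "cyc_next N i < N" "cyc_prev N i < N" "cyc_next N i \<noteq> i" "cyc_prev N i \<noteq> i"
    "cyc_next N i \<noteq> cyc_prev N i" "cyc_next N (cyc_prev N i) = i" "cyc_prev N (cyc_next N i) = i"
  using assms by (auto simp: cyc_next_def cyc_prev_def)

text \<open>A 2x2 minor; for \<open>j = Suc i\<close> it is the Casoratian, the discrete Wronskian,
  of the two sequences.\<close>

definition bracket :: "(nat \<Rightarrow> complex) \<Rightarrow> (nat \<Rightarrow> complex) \<Rightarrow> nat \<Rightarrow> nat \<Rightarrow> complex" where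
  "bracket A B i j = A i * B j - A j * B i"

text \<open>This is the Pluecker relation between three vectors \<open>(A i, B i)\<close> of the
  plane, divided by the product of the two neighbouring brackets. In this form both sequences solve
  one symmetric three-term recurrence.\<close>

lemma bracket_three_term:
  assumes "bracket A B k (Suc k) \<noteq> 0" "bracket A B (Suc k) (k + 2) \<noteq> 0"
  defines "v \<equiv> bracket A B k (k + 2) / (bracket A B k (Suc k) * bracket A B (Suc k) (k + 2))"
  shows "A k / bracket A B k (Suc k) + A (k + 2) / bracket A B (Suc k) (k + 2) = v * A (Suc k)"
    "B k / bracket A B k (Suc k) + B (k + 2) / bracket A B (Suc k) (k + 2) = v * B (Suc k)"
  using assms(1,2) unfolding v_def
  by (simp_all add: divide_simps) (simp_all add: bracket_def algebra_simps)

text \<open>The inverse is a periodic Jacobi matrix, and the semiseparable matrix is its Green's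
  function: on either side of the diagonal each column solves the three-term recurrence, and
  crossing the diagonal causes a jump, which the factor \<open>1 / (\<mu> - \<nu>)\<close>
  normalises to 1.\<close>

lemma semisep_mat_inverse:
  assumes N: "N \<ge> 3" and nz: "\<mu> \<noteq> 0" "\<nu> \<noteq> 0" "\<mu> \<noteq> \<nu>"
    and w: "\<And>i. Suc i < N \<Longrightarrow> bracket a b i (Suc i) \<noteq> 0"
    and w0: "\<nu>\<^sup>2 * a (N - 1) * b 0 \<noteq> \<mu>\<^sup>2 * a 0 * b (N - 1)"
  shows "\<exists>K \<in> L_space N (cycle_graph N).
    inverts_mat K (semisep_mat N \<mu> \<nu> a b) \<and> inverts_mat (semisep_mat N \<mu> \<nu> a b) K"
proof -
  \<comment> \<open>Indices are shifted by one, so that 0 and \<open>Suc N\<close> are the cyclic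
    neighbours beyond the two ends. Going once around multiplies \<open>A\<close> by
    \<open>\<mu> / \<nu>\<close> and \<open>B\<close> by \<open>\<nu> / \<mu>\<close>; as the
    multipliers are reciprocal, the brackets close up (\<open>WN\<close>), and entries across the
    seam obey the same formulas as the others.\<close>
  define A where "A k = (if k = 0 then \<nu> / \<mu> * a (N - 1) else if k = Suc N then \<mu> / \<nu> * a 0 else a (k - 1))" for k
  define B where "B k = (if k = 0 then \<mu> / \<nu> * b (N - 1) else if k = Suc N then \<nu> / \<mu> * b 0 else b (k - 1))" for k
  define W where "W k = bracket A B k (Suc k)" for k
  define c where "c i = - bracket A B i (i + 2) / (W i * W (Suc i))" for i
  have WN: "W N = W 0" using N nz by (simp add: W_def bracket_def A_def B_def mult_ac)
  have W0: "W 0 \<noteq> 0" using w0 N nz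
    by (auto simp: W_def bracket_def A_def B_def power2_eq_square divide_simps mult_ac)
  have Wnz: "W k \<noteq> 0" if "k \<le> N" for k
  proof (cases "k = 0 \<or> k = N")
    case True
    then show ?thesis using W0 WN by auto
  next
    case False
    with that have "Suc (k - 1) < N" by linarith
    from w[OF this] False that show ?thesis by (auto simp: W_def bracket_def A_def B_def)
  qed
  define K0 where "K0 i l = (if l = i then c i else if l = cyc_next N i then 1 / W (Suc i)
      else if l = cyc_prev N i then 1 / W i else 0)" for i l
  define K where "K = mat N N (\<lambda>(i, l). K0 i l / (\<mu> - \<nu>))"
  define X where "X = semisep_mat N \<mu> \<nu> a b"
  have Kc: "K \<in> carrier_mat N N" and Xc: "X \<in> carrier_mat N N"
    by (auto simp: K_def X_def semisep_mat_def)
  have K0_sym: "K0 i l = K0 l i" if "i < N" "l < N" for i l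
    using that N WN
    by (auto simp: K0_def cyc_next_def cyc_prev_def split: if_splits)
  have K_L: "K \<in> L_space N (cycle_graph N)"
    unfolding L_space_def
  proof (intro CollectI conjI allI impI)
    show "K \<in> sym_mats N" using K0_sym by (auto simp: sym_mats_iff K_def)
    fix i j assume ij: "i < N" "j < N" "i \<noteq> j \<and> {i, j} \<notin> cycle_graph N"
    then have "j \<noteq> cyc_next N i" "i \<noteq> cyc_next N j"
      by (auto simp: cycle_graph_alt insert_commute)
    with ij cyc_simps[OF N] show "K $$ (i, j) = 0" by (auto simp: K_def K0_def)
  qed
  have "K * X = 1\<^sub>m N"
  proof (rule eq_matI)
    fix i j assume "i < dim_row (1\<^sub>m N :: complex mat)" "j < dim_col (1\<^sub>m N :: complex mat)"
    then have ij: "i < N" "j < N" by auto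
    note cs = cyc_simps[OF N ij(1)]
    \<comment> \<open>Column \<open>j\<close> of the matrix is given by \<open>L\<close> above the
      diagonal and by \<open>R\<close> below it, as functions of the shifted row index. The two
      agree on the diagonal, at \<open>Suc j\<close>.\<close>
    define L where "L k = \<mu> * A k * B (Suc j) + \<nu> * B k * A (Suc j)" for k
    define R where "R k = \<mu> * A (Suc j) * B k + \<nu> * B (Suc j) * A k" for k
    have prev: "X $$ (cyc_prev N i, j) = (if i \<le> Suc j then L i else R i)"
      using ij N nz
      by (auto simp: cyc_prev_def X_def semisep_mat_index semisep_mat_index' L_def R_def A_def B_def)
    have mid: "X $$ (i, j) = (if i \<le> j then L (Suc i) else R (Suc i))"
      using ij N nz
      by (auto simp: X_def semisep_mat_index semisep_mat_index' L_def R_def A_def B_def)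
    have nxt: "X $$ (cyc_next N i, j) = (if Suc i \<le> j then L (i + 2) else R (i + 2))"
      using ij N nz
      by (auto simp: cyc_next_def X_def semisep_mat_index semisep_mat_index' L_def R_def A_def B_def)
    have rec: "A i / W i + A (i + 2) / W (Suc i) + c i * A (Suc i) = 0"
      "B i / W i + B (i + 2) / W (Suc i) + c i * B (Suc i) = 0"
      using bracket_three_term[of A B i] Wnz[of i] Wnz[of "Suc i"] ij
      by (auto simp: W_def c_def)
    have recL: "L i / W i + L (i + 2) / W (Suc i) + c i * L (Suc i) = 0"
    proof -
      have "L i / W i + L (i + 2) / W (Suc i) + c i * L (Suc i)
        = \<mu> * B (Suc j) * (A i / W i + A (i + 2) / W (Suc i) + c i * A (Suc i))
          + \<nu> * A (Suc j) * (B i / W i + B (i + 2) / W (Suc i) + c i * B (Suc i))"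
        by (simp add: L_def algebra_simps add_divide_distrib)
      with rec show ?thesis by simp
    qed
    have recR: "R i / W i + R (i + 2) / W (Suc i) + c i * R (Suc i) = 0"
    proof -
      have "R i / W i + R (i + 2) / W (Suc i) + c i * R (Suc i)
        = \<nu> * B (Suc j) * (A i / W i + A (i + 2) / W (Suc i) + c i * A (Suc i))
          + \<mu> * A (Suc j) * (B i / W i + B (i + 2) / W (Suc i) + c i * B (Suc i))"
        by (simp add: R_def algebra_simps add_divide_distrib)
      with rec show ?thesis by simp
    qed
    have jump: "R (i + 2) - L (i + 2) = (\<mu> - \<nu>) * W (Suc i)" if "i = j"
      using that by (simp add: L_def R_def W_def bracket_def algebra_simps)
    have "(K * X) $$ (i, j) = (\<Sum>l<N. K $$ (i, l) * X $$ (l, j))"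
      using Kc Xc ij by (simp add: scalar_prod_def atLeast0LessThan)
    also have "\<dots> = (\<Sum>l\<in>{cyc_prev N i, i, cyc_next N i}. K $$ (i, l) * X $$ (l, j))"
      using cs ij by (intro sum.mono_neutral_right) (auto simp: K_def K0_def)
    also have "\<dots> = (X $$ (cyc_prev N i, j) / W i + c i * X $$ (i, j)
        + X $$ (cyc_next N i, j) / W (Suc i)) / (\<mu> - \<nu>)"
      using cs cs(3,4,5)[symmetric] ij by (simp add: K_def K0_def add_divide_distrib)
    also have "\<dots> = 1\<^sub>m N $$ (i, j)"
    proof (cases i j rule: linorder_cases)
      case less
      then show ?thesis using recL ij by (simp add: prev mid nxt algebra_simps)
    next
      case greater
      \<comment> \<open>For \<open>i = Suc j\<close> the preceding row meets column \<open>j\<close>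
        on the diagonal, where \<open>prev\<close> yields \<open>L\<close> instead of
        \<open>R\<close>.\<close>
      have "R (Suc j) = L (Suc j)" by (simp add: R_def L_def)
      with greater have "X $$ (cyc_prev N i, j) = R i" by (auto simp: prev le_Suc_eq)
      with greater show ?thesis using recR ij by (simp add: mid nxt algebra_simps)
    next
      case equal
      have "L i / W i + c i * L (Suc i) + R (i + 2) / W (Suc i)
        = (L i / W i + L (i + 2) / W (Suc i) + c i * L (Suc i)) + (R (i + 2) - L (i + 2)) / W (Suc i)"
        by (simp add: diff_divide_distrib)
      also have "\<dots> = \<mu> - \<nu>" using recL jump[OF equal] Wnz[of "Suc i"] ij by simp
      finally have step: "L i / W i + c i * L (Suc i) + R (i + 2) / W (Suc i) = \<mu> - \<nu>" .
      have X: "X $$ (cyc_prev N i, j) = L i" "X $$ (i, j) = L (Suc i)" "X $$ (cyc_next N i, j) = R (i + 2)"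
        unfolding prev mid nxt using equal by simp_all
      show ?thesis unfolding X step using equal ij nz by simp
    qed
    finally show "(K * X) $$ (i, j) = 1\<^sub>m N $$ (i, j)" .
  qed (use Kc Xc in auto)
  moreover from this have "X * K = 1\<^sub>m N" by (rule mat_mult_left_right_inverse[OF Kc Xc])
  ultimately have "inverts_mat K X \<and> inverts_mat X K"
    using Kc Xc by (simp add: inverts_mat_def)
  then show ?thesis using K_L unfolding X_def by blast
qed

section \<open>Passing to the Zariski closure\<close>

lemma matrix_polynomial_on_curve:
  assumes "matrix_polynomial N f"
    and "\<And>i j. i < N \<Longrightarrow> j < N \<Longrightarrow> \<exists>p. \<forall>t. X t $$ (i, j) = poly p t"
  shows "\<exists>p. \<forall>t. f (X t) = poly p t"
  using assms(1)
proof induction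
  case (const c)
  show ?case by (rule exI[of _ "[:c:]"]) simp
next
  case (add f g)
  then show ?case by (metis poly_add)
next
  case (mult f g)
  then show ?case by (metis poly_mult)
qed (rule assms(2))

text \<open>Parameters to which the explicit inverse applies are dense: every line through
  \<open>a = (1, 1, \<dots>)\<close>, \<open>b = (0, 1, 2, \<dots>)\<close>, \<open>\<mu> = 2\<close>, \<open>\<nu> = 1\<close> misses them only finitely often.\<close>

lemma semisep_mat_in_L_inv:
  assumes N: "N \<ge> 3"
  shows "semisep_mat N \<mu> \<nu> a b \<in> L_inv N (cycle_graph N)"
  unfolding L_inv_def zariski_closure_def
proof (intro CollectI conjI allI impI semisep_mat_sym)
  fix f
  assume "matrix_polynomial N f \<and>
    (\<forall>X\<in>{B \<in> carrier_mat N N. \<exists>A\<in>L_space N (cycle_graph N). inverts_mat A B \<and> inverts_mat B A}. f X = 0)"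
  then have f: "matrix_polynomial N f"
    and f0: "\<And>X K. X \<in> carrier_mat N N \<Longrightarrow> K \<in> L_space N (cycle_graph N) \<Longrightarrow> inverts_mat K X
      \<Longrightarrow> inverts_mat X K \<Longrightarrow> f X = 0"
    by blast+
  define a' where "a' i = [:a i, 1 - a i:]" for i
  define b' where "b' i = [:b i, of_nat i - b i:]" for i
  define m where "m = [:\<mu>, 2 - \<mu>:]"
  define n where "n = [:\<nu>, 1 - \<nu>:]"
  define X where "X t = semisep_mat N (poly m t) (poly n t) (\<lambda>i. poly (a' i) t) (\<lambda>i. poly (b' i) t)" for t
  have "\<exists>p. \<forall>t. X t $$ (i, j) = poly p t" if "i < N" "j < N" for i j
    using that by (intro exI[of _ "m * a' (min i j) * b' (max i j) + n * b' (min i j) * a' (max i j)"])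
      (simp add: X_def semisep_mat_def)
  then obtain p where p: "\<And>t. f (X t) = poly p t"
    using matrix_polynomial_on_curve[OF f, of X] by blast
  define w where "w i = a' i * b' (Suc i) - a' (Suc i) * b' i" for i
  define w0 where "w0 = n\<^sup>2 * a' (N - 1) * b' 0 - m\<^sup>2 * a' 0 * b' (N - 1)"
  \<comment> \<open>This product collects all nonvanishing conditions of
    \<open>semisep_mat_inverse\<close>; at the base point every \<open>w i\<close> equals 1.\<close>
  define q where "q = m * n * (m - n) * w0 * (\<Prod>i<N - 1. w i)"
  have "poly (w i) 1 = 1" for i by (simp add: w_def a'_def b'_def algebra_simps)
  moreover have "poly w0 1 \<noteq> 0" using N by (simp add: w0_def a'_def b'_def m_def n_def of_nat_diff)
  moreover have "poly m 1 = 2" "poly n 1 = 1" by (simp_all add: m_def n_def)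
  ultimately have "poly q 1 \<noteq> 0" by (simp add: q_def poly_prod)
  then have "q \<noteq> 0" by auto
  have good: "f (X t) = 0" if "poly q t \<noteq> 0" for t
  proof -
    have "\<exists>K \<in> L_space N (cycle_graph N). inverts_mat K (X t) \<and> inverts_mat (X t) K"
      unfolding X_def using that
      by (intro semisep_mat_inverse[OF N]) (auto simp: q_def poly_prod w_def w0_def bracket_def)
    then show ?thesis using f0[of "X t"] by (auto simp: X_def semisep_mat_def)
  qed
  \<comment> \<open>Wherever \<open>q\<close> does not vanish the matrix is an inverse, so
    \<open>p * q\<close> vanishes identically. Cancelling \<open>q\<close> gives the claim at
    \<open>t = 0\<close>, where the matrix itself may be singular.\<close>
  have "poly (p * q) t = 0" for t using good[of t] p by auto
  then have "p * q = 0" using poly_all_0_iff_0 by blast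
  with \<open>q \<noteq> 0\<close> have "p = 0" by simp
  then have "f (X 0) = 0" by (simp add: p)
  then show "f (semisep_mat N \<mu> \<nu> a b) = 0"
    by (simp add: X_def m_def n_def a'_def b'_def)
qed

section \<open>Points of the fibre\<close>

text \<open>The trace pairing of \<open>X - S\<close> with a matrix of \<open>L_space\<close> only
  sees positions on the diagonal and on edges, and there the difference vanishes.\<close>

lemma mem_fibre:
  assumes N: "N \<ge> 3" and X: "X \<in> L_inv N (cycle_graph N)" and S: "S \<in> sym_mats N"
    and diag: "\<And>i. i < N \<Longrightarrow> X $$ (i, i) = S $$ (i, i)"
    and edge: "\<And>i. i < N \<Longrightarrow> X $$ (i, cyc_next N i) = S $$ (i, cyc_next N i)"
  shows "X \<in> {S + A | A. A \<in> L_perp N (cycle_graph N)} \<inter> L_inv N (cycle_graph N)"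
proof -
  have Xs: "X \<in> sym_mats N" using X by (simp add: L_inv_def zariski_closure_def)
  then have Xc: "X \<in> carrier_mat N N" and Sc: "S \<in> carrier_mat N N"
    and XS: "\<And>i j. i < N \<Longrightarrow> j < N \<Longrightarrow> X $$ (i, j) = X $$ (j, i) \<and> S $$ (i, j) = S $$ (j, i)"
    using S by (auto simp: sym_mats_iff)
  have edge': "X $$ (i, j) = S $$ (i, j)" if ij: "i < N" "j < N" "i = j \<or> {i, j} \<in> cycle_graph N" for i j
  proof (cases "i = j")
    case False
    then obtain k where "k < N" "{i, j} = {k, cyc_next N k}" using ij by (auto simp: cycle_graph_alt)
    then show ?thesis using edge[of k] XS ij by (auto simp: doubleton_eq_iff)
  qed (use diag ij in auto)
  have "(\<Sum>i<N. (M * (X - S)) $$ (i, i)) = 0" if M: "M \<in> L_space N (cycle_graph N)" for M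
  proof -
    have Mc: "M \<in> carrier_mat N N" using M by (simp add: L_space_def sym_mats_def)
    have "M $$ (i, l) * (X $$ (l, i) - S $$ (l, i)) = 0" if "i < N" "l < N" for i l
    proof (cases "i = l \<or> {i, l} \<in> cycle_graph N")
      case True
      then show ?thesis using edge'[of l i] that by (auto simp: insert_commute)
    next
      case False
      then show ?thesis using M that by (auto simp: L_space_def)
    qed
    then show ?thesis using Mc Xc Sc by (auto simp: scalar_prod_def intro!: sum.neutral)
  qed
  then have "X - S \<in> L_perp N (cycle_graph N)"
    using Xc Sc XS by (auto simp: L_perp_def sym_mats_iff)
  moreover have "X = S + (X - S)" using Xc Sc by (intro eq_matI) auto
  ultimately show ?thesis using X by blast
qed

text \<open>If the diagonal of \<open>S\<close> is prescribed, only the ratios \<open>r i = a (i + 1) / a i\<close> matter. Each edge of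
  the path \<open>0, \<dots>, N - 1\<close> determines one of them up to the choice of a root of a quadratic
  equation; the remaining edge is the equation for \<open>\<mu>\<close>.\<close>

lemma fibre_point:
  assumes N: "N \<ge> 3" and S: "S \<in> sym_mats N" and sum1: "\<mu> + \<nu> = 1"
    and r: "\<And>i. Suc i < N \<Longrightarrow> r i \<noteq> 0"
    and path: "\<And>i. Suc i < N \<Longrightarrow>
      \<mu> * S $$ (Suc i, Suc i) / r i + \<nu> * S $$ (i, i) * r i = S $$ (i, Suc i)"
    and closing: "\<mu> * S $$ (N - 1, N - 1) / prod r {..<N - 1} + \<nu> * S $$ (0, 0) * prod r {..<N - 1}
      = S $$ (0, N - 1)"
  shows "\<exists>X \<in> {S + A | A. A \<in> L_perp N (cycle_graph N)} \<inter> L_inv N (cycle_graph N).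
    \<forall>i j. i \<le> j \<and> j < N \<longrightarrow>
      X $$ (i, j) = \<mu> * S $$ (j, j) / prod r {i..<j} + \<nu> * S $$ (i, i) * prod r {i..<j}"
proof -
  \<comment> \<open>Normalised by \<open>a 0 = 1\<close>; the diagonal conditions then force
    \<open>b i = S $$ (i, i) / a i\<close>.\<close>
  define a where "a i = prod r {..<i}" for i
  define X where "X = semisep_mat N \<mu> \<nu> a (\<lambda>i. S $$ (i, i) / a i)"
  have a: "a i \<noteq> 0" if "i < N" for i using that r by (auto simp: a_def)
  have a_mult: "a j = a i * prod r {i..<j}" if "i \<le> j" for i j
    using prod.atLeastLessThan_concat[of 0 i j r] that by (simp add: a_def lessThan_atLeast0)
  have X_ij: "X $$ (i, j) = \<mu> * S $$ (j, j) / prod r {i..<j} + \<nu> * S $$ (i, i) * prod r {i..<j}"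
    if "i \<le> j" "j < N" for i j
    using that a[of i] a[of j] a_mult[of i j] by (simp add: X_def semisep_mat_index)
  have Xc: "X \<in> L_inv N (cycle_graph N)" unfolding X_def by (rule semisep_mat_in_L_inv[OF N])
  have diag: "X $$ (i, i) = S $$ (i, i)" if "i < N" for i
    using X_ij[of i i] that sum1 by (simp flip: distrib_right)
  have edge: "X $$ (i, cyc_next N i) = S $$ (i, cyc_next N i)" if "i < N" for i
  proof (cases "Suc i = N")
    case True
    have "X $$ (i, 0) = X $$ (0, i)" using that N by (simp add: X_def semisep_mat_def)
    moreover have "S $$ (i, 0) = S $$ (0, i)" using S that N by (auto simp: sym_mats_iff)
    moreover have "i = N - 1" using True by simp
    ultimately show ?thesis
      using True X_ij[of 0 i] closing by (simp add: cyc_next_def atLeast0LessThan)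
  next
    case False
    then show ?thesis using X_ij[of i "Suc i"] path[of i] that by (simp add: cyc_next_def)
  qed
  show ?thesis using mem_fibre[OF N Xc S diag edge] X_ij by blast
qed

section \<open>Persistence of isolated zeros and of separated points under perturbation\<close>

text \<open>A minimum modulus argument. On a small circle around the isolated zero the modulus at
  \<open>t = 0\<close> is at least some \<open>m > 0\<close>. For small \<open>t\<close> uniform
  continuity keeps it above \<open>m / 2\<close> on the circle and below \<open>m / 2\<close> at the
  centre, which forces a zero inside. Being close to \<open>l0\<close>, that zero inherits
  \<open>Q\<close>.\<close>

lemma root_persistence:
  fixes g :: "complex \<Rightarrow> complex \<Rightarrow> complex"
  assumes cont: "\<forall>\<^sub>F z in nhds (l0, 0). isCont (\<lambda>z. g (fst z) (snd z)) z"
    and diff: "\<forall>\<^sub>F z in nhds (l0, 0). (\<lambda>l. g l (snd z)) field_differentiable at (fst z)"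
    and zero: "g l0 0 = 0" and isolated: "\<forall>\<^sub>F l in at l0. g l 0 \<noteq> 0"
    and Q: "\<forall>\<^sub>F z in nhds (l0, 0). Q (fst z) (snd z)"
  shows "\<forall>\<^sub>F t in at 0. \<exists>l. g l t = 0 \<and> Q l t"
proof -
  have "\<forall>\<^sub>F z in nhds l0 \<times>\<^sub>F nhds 0. isCont (\<lambda>z. g (fst z) (snd z)) z \<and>
      (\<lambda>l. g l (snd z)) field_differentiable at (fst z) \<and> Q (fst z) (snd z)"
    using cont diff Q by (auto simp: nhds_prod eventually_conj_iff)
  then obtain U V where U: "eventually U (nhds l0)" and V: "eventually V (nhds 0)"
    and UV: "\<And>l t. U l \<Longrightarrow> V t \<Longrightarrow> isCont (\<lambda>z. g (fst z) (snd z)) (l, t) \<and>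
      (\<lambda>l. g l t) field_differentiable at l \<and> Q l t"
    by (auto simp: eventually_prod_filter)
  obtain r1 where r1: "r1 > 0" "\<And>l. dist l l0 < r1 \<Longrightarrow> U l" using U by (auto simp: eventually_nhds_metric)
  obtain r2 where r2: "r2 > 0" "\<And>l. dist l l0 < r2 \<Longrightarrow> l \<noteq> l0 \<Longrightarrow> g l 0 \<noteq> 0"
    using isolated by (auto simp: eventually_at)
  obtain s1 where s1: "s1 > 0" "\<And>t. dist t 0 < s1 \<Longrightarrow> V t" using V by (auto simp: eventually_nhds_metric)
  \<comment> \<open>Halving keeps the closed balls inside the open neighbourhoods, so compactness is
    available.\<close>
  define r where "r = min r1 r2 / 2"
  define s where "s = s1 / 2"
  have rs: "r > 0" "r < r1" "r < r2" "s > 0" "s < s1" using r1(1) r2(1) s1(1) by (auto simp: r_def s_def)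
  have good: "isCont (\<lambda>z. g (fst z) (snd z)) (l, t) \<and> (\<lambda>l. g l t) field_differentiable at l \<and> Q l t"
    if "l \<in> cball l0 r" "t \<in> cball 0 s" for l t
    using that rs by (intro UV r1 s1) (auto simp: dist_commute)
  have contK: "continuous_on (cball l0 r \<times> cball 0 s) (\<lambda>z. g (fst z) (snd z))"
    using good by (auto intro!: continuous_at_imp_continuous_on)
  then have unif: "uniformly_continuous_on (cball l0 r \<times> cball 0 s) (\<lambda>z. g (fst z) (snd z))"
    by (intro compact_uniformly_continuous compact_Times compact_cball)
  have "continuous_on (sphere l0 r) (\<lambda>l. norm (g l 0))"
  proof -
    have "continuous_on (sphere l0 r) ((\<lambda>z. g (fst z) (snd z)) \<circ> (\<lambda>l. (l, 0)))"
      using rs by (intro continuous_on_compose continuous_on_subset[OF contK] continuous_intros) auto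
    then show ?thesis by (simp add: o_def continuous_on_norm)
  qed
  then obtain l1 where l1: "l1 \<in> sphere l0 r" "\<And>l. l \<in> sphere l0 r \<Longrightarrow> norm (g l1 0) \<le> norm (g l 0)"
    using continuous_attains_inf[of "sphere l0 r" "\<lambda>l. norm (g l 0)"] rs by auto
  define m where "m = norm (g l1 0)"
  have m: "m > 0" using r2(2)[of l1] l1(1) rs by (auto simp: m_def dist_commute)
  then obtain d where d: "d > 0" "\<And>z z'. z \<in> cball l0 r \<times> cball 0 s \<Longrightarrow> z' \<in> cball l0 r \<times> cball 0 s \<Longrightarrow>
      dist z' z < d \<Longrightarrow> dist (g (fst z') (snd z')) (g (fst z) (snd z)) < m / 2"
    using unif unfolding uniformly_continuous_on_def by (meson half_gt_zero)
  have "\<exists>l. g l t = 0 \<and> Q l t" if t: "norm t < d" "norm t < s" for t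
  proof -
    have near: "dist (g l t) (g l 0) < m / 2" if "l \<in> cball l0 r" for l
      using d(2)[of "(l, 0)" "(l, t)"] that t rs by (auto simp: dist_Pair_Pair)
    have "norm (g l0 t) < norm (g l t)" if "norm (l0 - l) = r" for l
    proof -
      have "norm (g l0 t) < m / 2" using near[of l0] rs zero by simp
      moreover have "m \<le> norm (g l 0)" using l1(2)[of l] that by (simp add: m_def dist_norm)
      moreover have "norm (g l 0) \<le> norm (g l t) + dist (g l t) (g l 0)"
        by (metis add.commute dist_commute dist_norm norm_triangle_sub)
      moreover have "dist (g l t) (g l 0) < m / 2" using near[of l] that by (simp add: dist_norm)
      ultimately show ?thesis by linarith
    qed
    moreover have "continuous_on (cball l0 r) (\<lambda>l. g l t)"
      using good[of _ t] t by (auto intro!: continuous_at_imp_continuous_on field_differentiable_imp_continuous_at)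
    moreover have "(\<lambda>l. g l t) holomorphic_on ball l0 r"
      using good[of _ t] t
      by (auto simp: holomorphic_on_def intro: field_differentiable_at_within)
    ultimately obtain l where "l \<in> ball l0 r" "g l t = 0"
      using holomorphic_contract_to_zero[of l0 r "\<lambda>l. g l t"] rs by blast
    then show ?thesis using good[of l t] t by auto
  qed
  then show ?thesis
    unfolding eventually_at using d(1) rs by (intro exI[of _ "min d s"]) auto
qed

text \<open>There are finitely many limits, so one \<open>\<eta>\<close> is below half of a
  separating entrywise distance for every pair. Points of \<open>F t\<close> within
  \<open>\<eta>\<close> of different limits are then different, and for a suitable small
  \<open>t\<close> the set \<open>F t\<close> has exactly \<open>d\<close> elements.\<close>

lemma card_le_of_perturbation:
  assumes "finite I"
    and near: "\<And>k \<eta>. k \<in> I \<Longrightarrow> \<eta> > 0 \<Longrightarrow> \<forall>\<^sub>F t in at (0 :: complex). \<exists>X \<in> F t.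
      \<forall>i j. i \<le> j \<and> j < N \<longrightarrow> norm (X $$ (i, j) - \<phi> k i j) < \<eta>"
    and distinct: "\<And>k k'. k \<in> I \<Longrightarrow> k' \<in> I \<Longrightarrow> k \<noteq> k' \<Longrightarrow> \<exists>i j. i \<le> j \<and> j < N \<and> \<phi> k i j \<noteq> \<phi> k' i j"
    and card: "\<forall>\<^sub>F t in at 0. finite (F t) \<and> card (F t) = d"
  shows "card I \<le> d"
proof -
  have "\<forall>\<^sub>F \<eta> in at_right (0 :: real). \<forall>k\<in>I. \<forall>k'\<in>I. k \<noteq> k' \<longrightarrow>
      (\<exists>i j. i \<le> j \<and> j < N \<and> 2 * \<eta> < norm (\<phi> k i j - \<phi> k' i j))"
  proof (intro eventually_ball_finite \<open>finite I\<close> ballI)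
    fix k k' assume k: "k \<in> I" "k' \<in> I"
    show "\<forall>\<^sub>F \<eta> in at_right 0. k \<noteq> k' \<longrightarrow> (\<exists>i j. i \<le> j \<and> j < N \<and> 2 * \<eta> < norm (\<phi> k i j - \<phi> k' i j))"
    proof (cases "k = k'")
      case False
      then obtain i j where ij: "i \<le> j" "j < N" "\<phi> k i j \<noteq> \<phi> k' i j" using distinct k by blast
      then have "\<forall>\<^sub>F \<eta> in at_right 0. \<eta> < norm (\<phi> k i j - \<phi> k' i j) / 2"
        by (intro eventually_at_rightI[of 0 "norm (\<phi> k i j - \<phi> k' i j) / 2"]) auto
      then show ?thesis by eventually_elim (use ij in force)
    qed simp
  qed
  then have "\<forall>\<^sub>F \<eta> in at_right (0 :: real). 0 < \<eta> \<and> (\<forall>k\<in>I. \<forall>k'\<in>I. k \<noteq> k' \<longrightarrow>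
      (\<exists>i j. i \<le> j \<and> j < N \<and> 2 * \<eta> < norm (\<phi> k i j - \<phi> k' i j)))"
    by (intro eventually_conj eventually_at_right_less)
  from eventually_happens'[OF _ this] obtain \<eta> where \<eta>: "\<eta> > 0" and sep: "\<And>k k'. k \<in> I \<Longrightarrow> k' \<in> I \<Longrightarrow> k \<noteq> k' \<Longrightarrow>
      \<exists>i j. i \<le> j \<and> j < N \<and> 2 * \<eta> < norm (\<phi> k i j - \<phi> k' i j)" by auto
  have "\<forall>\<^sub>F t in at 0. \<forall>k\<in>I. \<exists>X \<in> F t. \<forall>i j. i \<le> j \<and> j < N \<longrightarrow> norm (X $$ (i, j) - \<phi> k i j) < \<eta>"
    using near \<eta> by (intro eventually_ball_finite \<open>finite I\<close> ballI) auto
  from eventually_happens'[OF _ eventually_conj[OF card this]] obtain t where t: "finite (F t)" "card (F t) = d"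
    "\<forall>k\<in>I. \<exists>X \<in> F t. \<forall>i j. i \<le> j \<and> j < N \<longrightarrow> norm (X $$ (i, j) - \<phi> k i j) < \<eta>" by auto
  then obtain X where X: "\<And>k. k \<in> I \<Longrightarrow> X k \<in> F t"
    "\<And>k i j. k \<in> I \<Longrightarrow> i \<le> j \<Longrightarrow> j < N \<Longrightarrow> norm (X k $$ (i, j) - \<phi> k i j) < \<eta>" by metis
  have "inj_on X I"
  proof (rule inj_onI, rule ccontr)
    fix k k' assume k: "k \<in> I" "k' \<in> I" "X k = X k'" "k \<noteq> k'"
    then obtain i j where ij: "i \<le> j" "j < N" "2 * \<eta> < norm (\<phi> k i j - \<phi> k' i j)" using sep by blast
    moreover have "norm (\<phi> k i j - \<phi> k' i j) \<le> norm (X k $$ (i, j) - \<phi> k i j) + norm (X k' $$ (i, j) - \<phi> k' i j)"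
      using norm_triangle_ineq4[of "X k' $$ (i, j) - \<phi> k' i j" "X k $$ (i, j) - \<phi> k i j"] k(3)
      by (simp add: norm_minus_commute)
    ultimately show False using X(2)[OF k(1) ij(1,2)] X(2)[OF k(2) ij(1,2)] by linarith
  qed
  then show ?thesis using card_inj_on_le[of X I "F t"] X(1) t by auto
qed

section \<open>Local continuity and complex differentiability\<close>

lemma eventually_nhds_isCont:
  assumes "isCont f p" "open A" "f p \<in> A"
  shows "\<forall>\<^sub>F z in nhds p. f z \<in> A"
  using assms by (metis continuous_at tendsto_at_iff_tendsto_nhds topological_tendstoD)

lemma eventually_nhds_neq:
  fixes f :: "'a :: t2_space \<Rightarrow> 'b :: t1_space"
  assumes "isCont f p" "f p \<noteq> c"
  shows "\<forall>\<^sub>F z in nhds p. f z \<noteq> c"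
  using eventually_nhds_isCont[of p f "- {c}"] assms by auto

lemma eventually_nhds_close:
  fixes f :: "'a :: t2_space \<Rightarrow> complex"
  assumes "isCont f p" "f p = c" "\<eta> > 0"
  shows "\<forall>\<^sub>F z in nhds p. norm (f z - c) < \<eta>"
  using eventually_nhds_isCont[of p f "ball c \<eta>"] assms
  by (auto simp: dist_norm norm_minus_commute)

lemma eventually_nhds_not_nonpos_Reals:
  fixes f :: "'a :: t2_space \<Rightarrow> complex"
  assumes "isCont f p" "f p \<notin> \<real>\<^sub>\<le>\<^sub>0"
  shows "\<forall>\<^sub>F z in nhds p. f z \<notin> \<real>\<^sub>\<le>\<^sub>0"
  using eventually_nhds_isCont[of p f "- \<real>\<^sub>\<le>\<^sub>0"] assms
    by (simp add: open_Compl)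

lemma field_differentiable_prod:
  assumes "\<And>i. i \<in> I \<Longrightarrow> f i field_differentiable at x"
  shows "(\<lambda>x. \<Prod>i\<in>I. f i x :: complex) field_differentiable at x"
proof -
  have "\<exists>f'. (f i has_field_derivative f') (at x)" if "i \<in> I" for i
    using assms[OF that] by (simp add: field_differentiable_def)
  then obtain f' where "\<And>i. i \<in> I \<Longrightarrow> (f i has_field_derivative f' i) (at x)" by metis
  then have "((\<lambda>x. \<Prod>i\<in>I. f i x) has_field_derivative (\<Sum>i\<in>I. f' i * (\<Prod>j\<in>I - {i}. f j x))) (at x)"
    by (rule has_field_derivative_prod)
  then show ?thesis by (auto simp: field_differentiable_def)
qed

lemma field_differentiable_csqrt:
  assumes "f field_differentiable at x" "f x \<notin> \<real>\<^sub>\<le>\<^sub>0"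
  shows "(\<lambda>x. csqrt (f x)) field_differentiable at x"
  using field_differentiable_compose[OF assms(1) field_differentiable_at_csqrt[OF assms(2)]]
  by (simp add: o_def)

lemmas fd_intros = field_differentiable_prod field_differentiable_csqrt field_differentiable_divide
  field_differentiable_mult field_differentiable_add field_differentiable_diff field_differentiable_power
  field_differentiable_const field_differentiable_ident field_differentiable_minus

lemma eventually_at_not_in_finite:
  fixes z :: complex
  assumes "finite A"
  shows "\<forall>\<^sub>F l in at z. l \<notin> A"
  using islimpt_finite[OF assms, of z] by (simp add: islimpt_iff_eventually)

section \<open>Perturbation of the identity matrix\<close>

text \<open>With \<open>\<nu> = 1 / (1 - l^2)\<close> and \<open>\<mu> = - l^2 \<nu>\<close> the
  path equations at \<open>t = 0\<close> read \<open>r i ^ 2 = l^2\<close>, so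
  \<open>r i = d i * l\<close> with a free sign, and the closing equation becomes
  \<open>l ^ (2 * (N - 2)) = 1\<close>. For small \<open>t\<close> the quadratics are solved
  explicitly, which leaves the single equation \<open>g l t = 0\<close> near
  \<open>l = z\<close>.\<close>

lemma fibre_near_root_of_unity:
  fixes S :: "complex \<Rightarrow> complex mat" and b c d :: "nat \<Rightarrow> complex"
  assumes N: "N \<ge> 3" and S: "\<And>t. S t \<in> sym_mats N"
    and diag: "\<And>i t. i < N \<Longrightarrow> S t $$ (i, i) = 1 + t * b i"
    and path: "\<And>i t. Suc i < N \<Longrightarrow> S t $$ (i, Suc i) = t * c i"
    and closing: "\<And>t. S t $$ (0, N - 1) = t * c (N - 1)"
    and d: "\<And>i. (d i)\<^sup>2 = 1" and z: "z ^ (2 * (N - 2)) = 1" "z\<^sup>2 \<noteq> 1" and \<eta>: "\<eta> > 0"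
  shows "\<forall>\<^sub>F t in at 0. \<exists>X \<in> {S t + A | A. A \<in> L_perp N (cycle_graph N)} \<inter> L_inv N (cycle_graph N).
    \<forall>i j. i \<le> j \<and> j < N \<longrightarrow>
      norm (X $$ (i, j) - (z ^ (j - i) - z\<^sup>2 / z ^ (j - i)) / (1 - z\<^sup>2) * prod d {i..<j}) < \<eta>"
proof -
  have z0: "z \<noteq> 0" using z(1) N by (auto simp: power_0_left)
  have d0: "d i \<noteq> 0" for i using d[of i] by auto
  have pd: "prod d A * prod d A = 1" if "finite A" for A
    using d by (simp add: prod.distrib[symmetric] power2_eq_square)
  define s where "s i t = 1 + t * b i" for i t
  \<comment> \<open>The discriminant with \<open>l^2\<close> taken out: it equals 1 at
    \<open>t = 0\<close>, hence the principal square root is holomorphic nearby, and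
    \<open>d i\<close> selects the root in \<open>r\<close>.\<close>
  define q where "q i l t = s i t * s (Suc i) t + (1 - l\<^sup>2)\<^sup>2 * (t * c i)\<^sup>2 / (4 * l\<^sup>2)" for i l t
  define r where "r i l t = ((1 - l\<^sup>2) * (t * c i) / 2 + d i * l * csqrt (q i l t)) / s i t" for i l t
  define E where "E i j l t = - l\<^sup>2 / (1 - l\<^sup>2) * s j t / (\<Prod>k=i..<j. r k l t)
    + 1 / (1 - l\<^sup>2) * s i t * (\<Prod>k=i..<j. r k l t)" for i j l t
  define g where "g l t = E 0 (N - 1) l t - t * c (N - 1)" for l t
  define good where "good l t \<longleftrightarrow> l \<noteq> 0 \<and> 1 - l\<^sup>2 \<noteq> 0 \<and> (\<forall>i<N. s i t \<noteq> 0)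
    \<and> (\<forall>i<N. q i l t \<notin> \<real>\<^sub>\<le>\<^sub>0) \<and> (\<forall>i<N. r i l t \<noteq> 0)" for l t
  have s0: "s i 0 = 1" for i by (simp add: s_def)
  have q0: "q i l 0 = 1" for i l by (simp add: q_def s0)
  have r0: "r i l 0 = d i * l" for i l by (simp add: r_def s0 q0)
  have E0: "E i j l 0 = (l ^ (j - i) - l\<^sup>2 / l ^ (j - i)) / (1 - l\<^sup>2) * prod d {i..<j}"
    if "l \<noteq> 0" for i j l
  proof -
    have "1 / prod d {i..<j} = prod d {i..<j}" using pd[of "{i..<j}"] d0 by (simp add: field_simps)
    then have "- l\<^sup>2 / (1 - l\<^sup>2) / (prod d {i..<j} * l ^ (j - i))
      = - l\<^sup>2 / (1 - l\<^sup>2) / l ^ (j - i) * prod d {i..<j}"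
      by (metis divide_divide_eq_left mult.commute divide_inverse mult_1)
    then show ?thesis by (simp add: E_def s0 r0 prod.distrib diff_divide_distrib algebra_simps)
  qed
  have cont_s: "isCont (\<lambda>p. s i (snd p)) p" for i and p :: "complex \<times> complex"
    unfolding s_def by (intro continuous_intros)
  have cont_q: "isCont (\<lambda>p. q i (fst p) (snd p)) p" if "fst p \<noteq> 0" for i and p :: "complex \<times> complex"
    unfolding q_def using that by (intro continuous_intros cont_s) auto
  have cont_r: "isCont (\<lambda>p. r i (fst p) (snd p)) p"
    if "fst p \<noteq> 0" "s i (snd p) \<noteq> 0" "q i (fst p) (snd p) \<notin> \<real>\<^sub>\<le>\<^sub>0" for i and p :: "complex \<times> complex"
    unfolding r_def using that by (intro continuous_intros cont_s isCont_csqrt' cont_q) auto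
  have cont_E: "isCont (\<lambda>p. E i j (fst p) (snd p)) p"
    if "good (fst p) (snd p)" "i < N" "j < N" for i j and p :: "complex \<times> complex"
    unfolding E_def using that by (intro continuous_intros cont_s cont_r) (auto simp: good_def)
  have "\<forall>\<^sub>F p in nhds (z, 0 :: complex). fst p \<noteq> 0"
    by (rule eventually_nhds_neq) (use z0 in \<open>auto intro!: continuous_intros\<close>)
  moreover have "\<forall>\<^sub>F p in nhds (z, 0 :: complex). 1 - (fst p)\<^sup>2 \<noteq> 0"
    by (rule eventually_nhds_neq) (use z(2) in \<open>auto intro!: continuous_intros\<close>)
  moreover have "\<forall>\<^sub>F p in nhds (z, 0). \<forall>i\<in>{..<N}. s i (snd p) \<noteq> 0"
    by (intro eventually_ball_finite ballI eventually_nhds_neq[OF cont_s]) (auto simp: s0)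
  moreover have "\<forall>\<^sub>F p in nhds (z, 0). \<forall>i\<in>{..<N}. q i (fst p) (snd p) \<notin> \<real>\<^sub>\<le>\<^sub>0"
    by (intro eventually_ball_finite ballI eventually_nhds_not_nonpos_Reals[OF cont_q]) (auto simp: q0 z0)
  moreover have "\<forall>\<^sub>F p in nhds (z, 0). \<forall>i\<in>{..<N}. r i (fst p) (snd p) \<noteq> 0"
    by (intro eventually_ball_finite ballI eventually_nhds_neq[OF cont_r]) (auto simp: s0 q0 r0 z0 d0)
  ultimately have ev_good: "\<forall>\<^sub>F p in nhds (z, 0). good (fst p) (snd p)"
    by eventually_elim (auto simp: good_def)
  then have good_z: "good z 0" using eventually_nhds_x_imp_x by force
  have g0: "g l 0 = (l ^ (N - 1) - l\<^sup>2 / l ^ (N - 1)) / (1 - l\<^sup>2) * prod d {0..<N - 1}" if "l \<noteq> 0" for l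
    using E0[OF that] by (simp add: g_def)
  have root: "g l 0 = 0 \<longleftrightarrow> l ^ (2 * (N - 2)) = 1" if "l \<noteq> 0" "l\<^sup>2 \<noteq> 1" for l
  proof -
    have "g l 0 = 0 \<longleftrightarrow> l ^ (N - 1) = l\<^sup>2 / l ^ (N - 1)" using that d0 by (simp add: g0)
    also have "\<dots> \<longleftrightarrow> l ^ (N - 1 + (N - 1)) = l\<^sup>2" using that by (simp add: field_simps power_add)
    also have "N - 1 + (N - 1) = 2 * (N - 2) + 2" using N by simp
    finally show ?thesis using that by (simp only: power_add) simp
  qed
  \<comment> \<open>The values 0, 1 and -1 are excluded as well, since \<open>root\<close> does not
    cover them.\<close>
  have "\<forall>\<^sub>F l in at z. l \<notin> {l. l ^ (2 * (N - 2)) = 1} \<union> {0, 1, -1}"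
    using N by (intro eventually_at_not_in_finite finite_UnI finite_roots_unity) auto
  then have isolated: "\<forall>\<^sub>F l in at z. g l 0 \<noteq> 0"
    by eventually_elim (use root in \<open>auto simp: power2_eq_1_iff\<close>)
  have "\<forall>\<^sub>F p in nhds (z, 0). \<forall>i\<in>{..<N}. \<forall>j\<in>{..<N}. norm (E i j (fst p) (snd p) - E i j z 0) < \<eta>"
    by (intro eventually_ball_finite ballI eventually_nhds_close[OF cont_E]) (auto simp: good_z \<eta>)
  with ev_good have Q: "\<forall>\<^sub>F p in nhds (z, 0). good (fst p) (snd p) \<and>
      (\<forall>i\<in>{..<N}. \<forall>j\<in>{..<N}. norm (E i j (fst p) (snd p) - E i j z 0) < \<eta>)"
    by (rule eventually_conj)
  have "\<forall>\<^sub>F t in at 0. \<exists>l. g l t = 0 \<and> good l t \<and> (\<forall>i\<in>{..<N}. \<forall>j\<in>{..<N}. norm (E i j l t - E i j z 0) < \<eta>)"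
  proof (rule root_persistence[where g = g and ?l0.0 = z, OF _ _ _ isolated])
    show "\<forall>\<^sub>F p in nhds (z, 0). isCont (\<lambda>p. g (fst p) (snd p)) p"
      using ev_good
    proof eventually_elim
      case (elim p)
      then show ?case unfolding g_def using N by (intro continuous_intros cont_E) auto
    qed
    show "\<forall>\<^sub>F p in nhds (z, 0). (\<lambda>l. g l (snd p)) field_differentiable at (fst p)"
      using ev_good
    proof eventually_elim
      case (elim p)
      have "(\<lambda>l. r i l (snd p)) field_differentiable at (fst p)" if "i < N" for i
        unfolding r_def using elim that
        by (intro fd_intros; simp add: good_def; simp add: q_def; intro fd_intros; simp)
      then show ?case unfolding g_def E_def using elim
        by (intro fd_intros) (auto simp: good_def)
    qed
    show "g z 0 = 0" using root z z0 by simp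
    show "\<forall>\<^sub>F p in nhds (z, 0). good (fst p) (snd p) \<and>
      (\<forall>i\<in>{..<N}. \<forall>j\<in>{..<N}. norm (E i j (fst p) (snd p) - E i j z 0) < \<eta>)" by (fact Q)
  qed
  then show ?thesis
  proof eventually_elim
    case (elim t)
    then obtain l where l: "g l t = 0" "good l t"
      and close: "\<And>i j. i < N \<Longrightarrow> j < N \<Longrightarrow> norm (E i j l t - E i j z 0) < \<eta>" by auto
    have l1: "l \<noteq> 0" "1 - l\<^sup>2 \<noteq> 0" using l(2) by (auto simp: good_def)
    have quad: "- l\<^sup>2 / (1 - l\<^sup>2) * s (Suc i) t / r i l t + 1 / (1 - l\<^sup>2) * s i t * r i l t = t * c i"
      if i: "Suc i < N" for i
    proof -
      \<comment> \<open>Half of the linear coefficient: the quadratic equation for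
        \<open>r i l t\<close> is verified by completing the square.\<close>
      define u where "u = (1 - l\<^sup>2) * (t * c i) / 2"
      define R where "R = csqrt (q i l t)"
      have R: "l\<^sup>2 * R\<^sup>2 = l\<^sup>2 * (s i t * s (Suc i) t) + u\<^sup>2"
      proof -
        have "R\<^sup>2 = q i l t" by (simp add: R_def)
        moreover have "l\<^sup>2 * ((1 - l\<^sup>2)\<^sup>2 * (t * c i)\<^sup>2 / (4 * l\<^sup>2)) = u\<^sup>2"
          using l1 by (simp add: u_def power_mult_distrib power_divide)
        ultimately show ?thesis by (simp add: q_def distrib_left)
      qed
      have si: "s i t \<noteq> 0" and ri: "r i l t \<noteq> 0" using l(2) i by (auto simp: good_def)
      have "s i t * r i l t = u + d i * l * R" using si by (simp add: r_def u_def R_def)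
      then have "(s i t * r i l t - u)\<^sup>2 = (d i)\<^sup>2 * (l\<^sup>2 * R\<^sup>2)" by (simp add: power_mult_distrib)
      also have "\<dots> = l\<^sup>2 * (s i t * s (Suc i) t) + u\<^sup>2" using d R by simp
      finally have "s i t * (s i t * (r i l t)\<^sup>2 - l\<^sup>2 * s (Suc i) t - 2 * u * r i l t) = 0"
        by (simp add: power2_eq_square algebra_simps)
      then have "s i t * (r i l t)\<^sup>2 - l\<^sup>2 * s (Suc i) t = (1 - l\<^sup>2) * (t * c i) * r i l t"
        using si by (simp add: u_def)
      moreover have "- l\<^sup>2 / (1 - l\<^sup>2) * s (Suc i) t / r i l t + 1 / (1 - l\<^sup>2) * s i t * r i l t
        = (s i t * (r i l t)\<^sup>2 - l\<^sup>2 * s (Suc i) t) / ((1 - l\<^sup>2) * r i l t)"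
        using ri by (simp add: diff_divide_distrib power2_eq_square)
      ultimately show ?thesis using ri l1(2) by simp
    qed
    have "\<exists>X \<in> {S t + A | A. A \<in> L_perp N (cycle_graph N)} \<inter> L_inv N (cycle_graph N).
      \<forall>i j. i \<le> j \<and> j < N \<longrightarrow> X $$ (i, j)
        = - l\<^sup>2 / (1 - l\<^sup>2) * S t $$ (j, j) / prod (\<lambda>k. r k l t) {i..<j}
          + 1 / (1 - l\<^sup>2) * S t $$ (i, i) * prod (\<lambda>k. r k l t) {i..<j}"
    proof (rule fibre_point[OF N S])
      show "- l\<^sup>2 / (1 - l\<^sup>2) + 1 / (1 - l\<^sup>2) = 1" using l1 by (simp add: field_simps)
      show "r i l t \<noteq> 0" if "Suc i < N" for i using l(2) that by (auto simp: good_def)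
      show "- l\<^sup>2 / (1 - l\<^sup>2) * S t $$ (Suc i, Suc i) / r i l t + 1 / (1 - l\<^sup>2) * S t $$ (i, i) * r i l t
        = S t $$ (i, Suc i)" if "Suc i < N" for i
        using quad[OF that] that by (simp add: diag path s_def)
      show "- l\<^sup>2 / (1 - l\<^sup>2) * S t $$ (N - 1, N - 1) / (\<Prod>i<N - 1. r i l t)
          + 1 / (1 - l\<^sup>2) * S t $$ (0, 0) * (\<Prod>i<N - 1. r i l t) = S t $$ (0, N - 1)"
        using l(1) N closing[of t] by (simp add: g_def E_def diag s_def atLeast0LessThan)
    qed
    then obtain X where X: "X \<in> {S t + A | A. A \<in> L_perp N (cycle_graph N)} \<inter> L_inv N (cycle_graph N)"
      "\<And>i j. i \<le> j \<Longrightarrow> j < N \<Longrightarrow> X $$ (i, j) = E i j l t"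
      by (fastforce simp: E_def s_def diag)
    then show ?case using close E0[OF z0] by (intro bexI[of _ X]) auto
  qed
qed

text \<open>The solution that tends to the identity matrix has \<open>\<nu> \<rightarrow> 0\<close> and \<open>r i \<rightarrow> \<infinity>\<close>. The rescaling
  \<open>\<nu> = t ^ N * l\<close>, \<open>r i = 1 / (t * \<zeta> i)\<close> makes the equations regular at \<open>t = 0\<close>.\<close>

lemma fibre_near_identity:
  fixes S :: "complex \<Rightarrow> complex mat" and b c :: "nat \<Rightarrow> complex"
  assumes N: "N \<ge> 3" and S: "\<And>t. S t \<in> sym_mats N"
    and diag: "\<And>i t. i < N \<Longrightarrow> S t $$ (i, i) = 1 + t * b i"
    and path: "\<And>i t. Suc i < N \<Longrightarrow> S t $$ (i, Suc i) = t * c i"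
    and closing: "\<And>t. S t $$ (0, N - 1) = t * c (N - 1)"
    and c: "\<And>i. i < N \<Longrightarrow> c i \<noteq> 0" and \<eta>: "\<eta> > 0"
  shows "\<forall>\<^sub>F t in at 0. \<exists>X \<in> {S t + A | A. A \<in> L_perp N (cycle_graph N)} \<inter> L_inv N (cycle_graph N).
    \<forall>i j. i \<le> j \<and> j < N \<longrightarrow> norm (X $$ (i, j) - (if i = j then 1 else 0)) < \<eta>"
proof -
  \<comment> \<open>The limit of \<open>l\<close>: at \<open>t = 0\<close> the closing equation
    reads \<open>l / prod c {..<N - 1} = c (N - 1)\<close>.\<close>
  define z where "z = prod c {..<N}"
  define s where "s i t = 1 + t * b i" for i t
  define m where "m l t = 1 - t ^ N * l" for l t :: complex
  \<comment> \<open>The path equation becomes a quadratic for \<open>x\<close>, the rescaled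
    variable \<open>\<zeta>\<close>. The factor \<open>(c i)^2\<close> is taken out of its
    discriminant, and \<open>x\<close> is the root that tends to \<open>c i\<close> and not to
    0.\<close>
  define q where "q i l t = 1 - 4 * m l t * s i t * s (Suc i) t * t ^ (N - 2) * l / (c i)\<^sup>2" for i l t
  define x where "x i l t = c i * (1 + csqrt (q i l t)) / (2 * m l t * s (Suc i) t)" for i l t
  \<comment> \<open>A product of \<open>j - i\<close> ratios contributes \<open>t\<close> to the
    power \<open>i - j\<close>, hence the two exponents. Both are positive for
    \<open>i < j < N\<close>, so the off-diagonal entries vanish at \<open>t = 0\<close>.\<close>
  define E where "E i j l t = m l t * s j t * t ^ (j - i) * (\<Prod>k=i..<j. x k l t)
    + t ^ (N - (j - i)) * l * s i t / (\<Prod>k=i..<j. x k l t)" for i j l t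
  \<comment> \<open>The closing equation divided by \<open>t\<close>; its second term has the
    exponent \<open>N - (N - 1) = 1\<close> and thus survives at \<open>t = 0\<close>.\<close>
  define g where "g l t = m l t * s (N - 1) t * t ^ (N - 2) * (\<Prod>k<N - 1. x k l t)
    + l * s 0 t / (\<Prod>k<N - 1. x k l t) - c (N - 1)" for l t
  define good where "good l t \<longleftrightarrow> m l t \<noteq> 0 \<and> (\<forall>i<N. s i t \<noteq> 0)
    \<and> (\<forall>i<N - 1. q i l t \<notin> \<real>\<^sub>\<le>\<^sub>0) \<and> (\<forall>i<N - 1. x i l t \<noteq> 0)" for l t
  have s0: "s i 0 = 1" for i by (simp add: s_def)
  have m0: "m l 0 = 1" for l using N by (simp add: m_def power_0_left)
  have q0: "q i l 0 = 1" for i l using N by (simp add: q_def s0 power_0_left)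
  have x0: "x i l 0 = c i" for i l by (simp add: x_def s0 m0 q0)
  have g0: "g l 0 = l / prod c {..<N - 1} - c (N - 1)" for l
    using N by (simp add: g_def s0 x0 power_0_left)
  have E0: "E i j z 0 = (if i = j then 1 else 0)" if "i \<le> j" "j < N" for i j
    using that by (auto simp: E_def s0 m0 power_0_left)
  have cont_s: "isCont (\<lambda>p. s i (snd p)) p" for i and p :: "complex \<times> complex"
    unfolding s_def by (intro continuous_intros)
  have cont_m: "isCont (\<lambda>p. m (fst p) (snd p)) p" for p :: "complex \<times> complex"
    unfolding m_def by (intro continuous_intros)
  have cont_q: "isCont (\<lambda>p. q i (fst p) (snd p)) p" if "i < N" for i and p :: "complex \<times> complex"
    unfolding q_def using c[OF that] by (intro continuous_intros cont_s cont_m) auto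
  have cont_x: "isCont (\<lambda>p. x i (fst p) (snd p)) p"
    if "Suc i < N" "m (fst p) (snd p) \<noteq> 0" "s (Suc i) (snd p) \<noteq> 0" "q i (fst p) (snd p) \<notin> \<real>\<^sub>\<le>\<^sub>0"
    for i and p :: "complex \<times> complex"
    unfolding x_def using that by (intro continuous_intros cont_s cont_m isCont_csqrt' cont_q) auto
  have cont_E: "isCont (\<lambda>p. E i j (fst p) (snd p)) p"
    if "good (fst p) (snd p)" "i < N" "j < N" for i j and p :: "complex \<times> complex"
    unfolding E_def using that by (intro continuous_intros cont_s cont_m cont_x) (auto simp: good_def)
  have "\<forall>\<^sub>F p in nhds (z, 0). m (fst p) (snd p) \<noteq> 0"
    by (rule eventually_nhds_neq[OF cont_m]) (simp add: m0)
  moreover have "\<forall>\<^sub>F p in nhds (z, 0). \<forall>i\<in>{..<N}. s i (snd p) \<noteq> 0"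
    by (intro eventually_ball_finite ballI eventually_nhds_neq[OF cont_s]) (auto simp: s0)
  moreover have "\<forall>\<^sub>F p in nhds (z, 0). \<forall>i\<in>{..<N - 1}. q i (fst p) (snd p) \<notin> \<real>\<^sub>\<le>\<^sub>0"
    by (intro eventually_ball_finite ballI eventually_nhds_not_nonpos_Reals[OF cont_q]) (auto simp: q0)
  moreover have "\<forall>\<^sub>F p in nhds (z, 0). \<forall>i\<in>{..<N - 1}. x i (fst p) (snd p) \<noteq> 0"
    by (intro eventually_ball_finite ballI eventually_nhds_neq[OF cont_x]) (auto simp: s0 m0 q0 x0 c)
  ultimately have ev_good: "\<forall>\<^sub>F p in nhds (z, 0). good (fst p) (snd p)"
    by eventually_elim (auto simp: good_def)
  then have good_z: "good z 0" using eventually_nhds_x_imp_x by force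
  have pc: "prod c {..<N - 1} \<noteq> 0" using c by auto
  have z: "z = prod c {..<N - 1} * c (N - 1)"
    using N prod.lessThan_Suc[of c "N - 1"] by (simp add: z_def)
  have "\<forall>\<^sub>F l in at z. l \<noteq> z" by (simp add: eventually_neq_at_within)
  then have isolated: "\<forall>\<^sub>F l in at z. g l 0 \<noteq> 0"
    by eventually_elim (use pc in \<open>auto simp: g0 z divide_eq_eq mult.commute\<close>)
  have "\<forall>\<^sub>F p in nhds (z, 0). \<forall>i\<in>{..<N}. \<forall>j\<in>{..<N}. norm (E i j (fst p) (snd p) - E i j z 0) < \<eta>"
    by (intro eventually_ball_finite ballI eventually_nhds_close[OF cont_E]) (auto simp: good_z \<eta>)
  with ev_good have Q: "\<forall>\<^sub>F p in nhds (z, 0). good (fst p) (snd p) \<and>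
      (\<forall>i\<in>{..<N}. \<forall>j\<in>{..<N}. norm (E i j (fst p) (snd p) - E i j z 0) < \<eta>)"
    by (rule eventually_conj)
  have "\<forall>\<^sub>F t in at 0. \<exists>l. g l t = 0 \<and> good l t \<and> (\<forall>i\<in>{..<N}. \<forall>j\<in>{..<N}. norm (E i j l t - E i j z 0) < \<eta>)"
  proof (rule root_persistence[where g = g and ?l0.0 = z, OF _ _ _ isolated])
    show "\<forall>\<^sub>F p in nhds (z, 0). isCont (\<lambda>p. g (fst p) (snd p)) p"
      using ev_good
    proof eventually_elim
      case (elim p)
      then show ?case unfolding g_def
        by (intro continuous_intros cont_s cont_m cont_x) (auto simp: good_def)
    qed
    show "\<forall>\<^sub>F p in nhds (z, 0). (\<lambda>l. g l (snd p)) field_differentiable at (fst p)"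
      using ev_good
    proof eventually_elim
      case (elim p)
      have fd_m: "(\<lambda>l. m l (snd p)) field_differentiable at (fst p)"
        unfolding m_def by (intro fd_intros)
      have "(\<lambda>l. q i l (snd p)) field_differentiable at (fst p)" if "i < N - 1" for i
        unfolding q_def using that c[of i] by (intro fd_intros fd_m) auto
      then have "(\<lambda>l. x i l (snd p)) field_differentiable at (fst p)" if "i < N - 1" for i
        unfolding x_def using elim that by (intro fd_intros fd_m) (auto simp: good_def)
      then show ?case unfolding g_def using elim
        by (intro fd_intros fd_m) (auto simp: good_def)
    qed
    show "g z 0 = 0" using pc by (simp add: g0 z)
    show "\<forall>\<^sub>F p in nhds (z, 0). good (fst p) (snd p) \<and>
      (\<forall>i\<in>{..<N}. \<forall>j\<in>{..<N}. norm (E i j (fst p) (snd p) - E i j z 0) < \<eta>)" by (fact Q)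
  qed
  \<comment> \<open>The rescaling can be undone only for nonzero \<open>t\<close>.\<close>
  moreover have "\<forall>\<^sub>F t in at 0. t \<noteq> (0 :: complex)" by (simp add: eventually_neq_at_within)
  ultimately show ?thesis
  proof eventually_elim
    case (elim t)
    then obtain l where t: "t \<noteq> 0" and l: "g l t = 0" "good l t"
      and close: "\<And>i j. i < N \<Longrightarrow> j < N \<Longrightarrow> norm (E i j l t - E i j z 0) < \<eta>" by auto
    define r where "r i = 1 / (t * x i l t)" for i
    have xi: "x i l t \<noteq> 0" if "i < N - 1" for i using l(2) that by (auto simp: good_def)
    have prod_r: "prod r {i..<j} = 1 / (t ^ (j - i) * (\<Prod>k=i..<j. x k l t))" for i j
      by (simp add: r_def prod_dividef prod.distrib)
    have tN: "t ^ N = t ^ (j - i) * t ^ (N - (j - i))" if "j < N" for i j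
      using that by (simp flip: power_add)
    have ratio: "m l t * s j t / prod r {i..<j} + t ^ N * l * s i t * prod r {i..<j} = E i j l t"
      if "j < N" for i j
      using t by (simp add: prod_r E_def tN[OF that, of i])
    have quad: "m l t * s (Suc i) t / r i + t ^ N * l * s i t * r i = t * c i" if i: "Suc i < N" for i
    proof -
      define A where "A = m l t * s (Suc i) t"
      define R where "R = csqrt (q i l t)"
      have A: "A \<noteq> 0" using l(2) i by (auto simp: A_def good_def)
      have ci: "c i \<noteq> 0" using c i by simp
      have "R\<^sup>2 = q i l t" by (simp add: R_def)
      then have R: "(c i)\<^sup>2 * (R\<^sup>2 - 1) = - 4 * A * s i t * t ^ (N - 2) * l"
        using ci by (simp add: q_def A_def field_simps)
      have X: "2 * A * x i l t = c i * (1 + R)" using A by (simp add: x_def A_def R_def)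
      have "4 * A * (A * (x i l t)\<^sup>2 - c i * x i l t) = (2 * A * x i l t)\<^sup>2 - 2 * c i * (2 * A * x i l t)"
        by (simp add: power2_eq_square algebra_simps)
      also have "\<dots> = (c i)\<^sup>2 * (R\<^sup>2 - 1)" unfolding X by (simp add: power2_eq_square algebra_simps)
      also have "\<dots> = 4 * A * (- s i t * t ^ (N - 2) * l)" unfolding R by (simp add: mult_ac)
      finally have "A * (x i l t)\<^sup>2 - c i * x i l t = - s i t * t ^ (N - 2) * l"
        by (subst (asm) mult_left_cancel) (use A in auto)
      then have "A * (x i l t)\<^sup>2 + s i t * t ^ (N - 2) * l = c i * x i l t" by (simp add: algebra_simps)
      then have "t * (A * x i l t + s i t * t ^ (N - 2) * l / x i l t) = t * c i"
        using xi[of i] i by (simp add: field_simps power2_eq_square)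
      moreover have "t ^ N * l * s i t * r i = t * (s i t * t ^ (N - 2) * l / x i l t)"
      proof -
        have "t ^ N = t * t * t ^ (N - 2)" using tN[of 2 0] N by (simp add: power2_eq_square)
        then show ?thesis using t by (simp add: r_def)
      qed
      ultimately show ?thesis by (simp add: r_def A_def distrib_left mult_ac)
    qed
    have "\<exists>X \<in> {S t + A | A. A \<in> L_perp N (cycle_graph N)} \<inter> L_inv N (cycle_graph N).
      \<forall>i j. i \<le> j \<and> j < N \<longrightarrow> X $$ (i, j)
        = m l t * S t $$ (j, j) / prod r {i..<j} + t ^ N * l * S t $$ (i, i) * prod r {i..<j}"
    proof (rule fibre_point[OF N S])
      show "m l t + t ^ N * l = 1" by (simp add: m_def)
      show "r i \<noteq> 0" if "Suc i < N" for i using xi[of i] that t by (simp add: r_def)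
      show "m l t * S t $$ (Suc i, Suc i) / r i + t ^ N * l * S t $$ (i, i) * r i = S t $$ (i, Suc i)"
        if "Suc i < N" for i
        using quad[OF that] that by (simp add: diag path s_def)
      have "E 0 (N - 1) l t = t * (g l t + c (N - 1))"
      proof -
        have "N - (N - 1) = 1" "t ^ (N - 1) = t * t ^ (N - 2)"
          using N by (auto simp flip: power_Suc simp: Suc_diff_le[symmetric] numeral_2_eq_2 Suc_diff_Suc)
        then show ?thesis by (simp add: E_def g_def atLeast0LessThan distrib_left mult_ac)
      qed
      then show "m l t * S t $$ (N - 1, N - 1) / prod r {..<N - 1} + t ^ N * l * S t $$ (0, 0) * prod r {..<N - 1}
        = S t $$ (0, N - 1)"
        using l(1) N ratio[of "N - 1" 0] closing[of t] by (simp add: diag s_def atLeast0LessThan)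
    qed
    then obtain X where X: "X \<in> {S t + A | A. A \<in> L_perp N (cycle_graph N)} \<inter> L_inv N (cycle_graph N)"
      "\<And>i j. i \<le> j \<Longrightarrow> j < N \<Longrightarrow> X $$ (i, j) = E i j l t"
      using ratio by (fastforce simp: s_def diag)
    have "norm (X $$ (i, j) - (if i = j then 1 else 0)) < \<eta>" if "i \<le> j" "j < N" for i j
      using close[of i j] that by (simp add: E0 X(2))
    then show ?case using X(1) by blast
  qed
qed

section \<open>The lower bound for cycles\<close>

text \<open>Sign choices are encoded by sets of path edges so that they can be counted by
  \<open>Pow\<close>.\<close>

definition sgn_of :: "nat set \<Rightarrow> nat \<Rightarrow> complex" where
  "sgn_of T i = (if i \<in> T then - 1 else 1)"

text \<open>For \<open>i \<le> j\<close> this is the entry obtained from the identity matrix with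
  \<open>r k = sgn_of T k * z\<close> and \<open>\<nu> = 1 / (1 - z^2)\<close>. It is unchanged
  under \<open>z \<mapsto> 1 / z\<close>, and under \<open>z \<mapsto> - z\<close> combined with
  flipping all signs.\<close>

definition limit_entry :: "complex \<Rightarrow> nat set \<Rightarrow> nat \<Rightarrow> nat \<Rightarrow> complex" where
  "limit_entry z T i j = (z ^ (j - i) - z\<^sup>2 / z ^ (j - i)) / (1 - z\<^sup>2) * prod (sgn_of T) {i..<j}"

text \<open>At distance two the dependence on \<open>z\<close> cancels, which isolates the
  signs.\<close>

lemma limit_entry_2:
  assumes "z\<^sup>2 \<noteq> 1" "z \<noteq> 0"
  shows "limit_entry z T i (i + 2) = - (sgn_of T i * sgn_of T (Suc i))"
proof -
  have "{i..<i + 2} = {i, Suc i}" by auto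
  moreover have "(z\<^sup>2 - 1) / (1 - z\<^sup>2) = - 1" using assms by (simp add: field_simps)
  ultimately show ?thesis using assms by (simp add: limit_entry_def)
qed

lemma limit_entry_03:
  assumes "z\<^sup>2 \<noteq> 1" "z \<noteq> 0"
  shows "limit_entry z T 0 3 = - ((z + inverse z) * (sgn_of T 0 * sgn_of T 1 * sgn_of T 2))"
proof -
  have "{0..<3} = {0, 1, 2 :: nat}" by auto
  moreover have "z ^ 3 - z\<^sup>2 / z ^ 3 = - ((z + inverse z) * (1 - z\<^sup>2))"
    using assms(2) by (simp add: field_simps power2_eq_square power3_eq_cube)
  ultimately show ?thesis using assms(1)
    by (simp add: limit_entry_def mult.assoc) (simp add: algebra_simps)
qed

text \<open>Since 0 is in neither set, the first sign is fixed, and entries at distance two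
  determine the remaining signs one after another. The entry at (0, 3), available from
  \<open>N = 4\<close> on, then yields \<open>z + 1 / z\<close>.\<close>

lemma limit_entry_inj:
  assumes N: "N \<ge> 4" and z: "z\<^sup>2 \<noteq> 1" "z \<noteq> 0" "w\<^sup>2 \<noteq> 1" "w \<noteq> 0"
    and T: "T \<subseteq> {1..<N - 1}" "U \<subseteq> {1..<N - 1}"
    and eq: "\<And>i j. i \<le> j \<Longrightarrow> j < N \<Longrightarrow> limit_entry z T i j = limit_entry w U i j"
  shows "T = U \<and> z + inverse z = w + inverse w"
proof -
  have sgn_nz: "sgn_of V i \<noteq> 0" for V i by (simp add: sgn_of_def)
  have sgn_eq: "sgn_of T i = sgn_of U i" if "i < N - 1" for i
    using that
  proof (induction i)
    case 0
    then show ?case using T by (auto simp: sgn_of_def)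
  next
    case (Suc i)
    then have "sgn_of T i * sgn_of T (Suc i) = sgn_of U i * sgn_of U (Suc i)"
      using eq[of i "i + 2"] limit_entry_2[OF z(1,2), of T i] limit_entry_2[OF z(3,4), of U i] by simp
    with Suc sgn_nz[of U i] show ?case by simp
  qed
  have "i \<in> T \<longleftrightarrow> i \<in> U" for i
  proof (cases "i < N - 1")
    case True
    then show ?thesis using sgn_eq[of i] by (auto simp: sgn_of_def split: if_splits)
  qed (use T in auto)
  then have "T = U" by blast
  moreover have "z + inverse z = w + inverse w"
    using eq[of 0 3] N limit_entry_03[OF z(1,2), of T] limit_entry_03[OF z(3,4), of U] sgn_nz \<open>T = U\<close>
    by simp
  ultimately show ?thesis by simp
qed

section \<open>Generic directions and the count of limit points\<close>

lemma matrix_polynomial_prod: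
  fixes n :: nat
  assumes "\<And>i. i < n \<Longrightarrow> matrix_polynomial N (f i)"
  shows "matrix_polynomial N (\<lambda>M. \<Prod>i<n. f i M)"
  using assms
proof (induction n rule: nat_induct)
  case 0
  then show ?case by (simp add: matrix_polynomial.const)
next
  case (Suc n)
  then show ?case using matrix_polynomial.mult[of N "\<lambda>M. \<Prod>i<n. f i M" "f n"] by simp
qed

text \<open>Supplies a direction whose edge coefficients \<open>c i\<close> are nonzero, as
  \<open>fibre_near_identity\<close> demands. The witness is the all-ones matrix.\<close>

lemma for_generic_edges_nonzero:
  assumes "N \<ge> 3"
  shows "for_generic N (\<lambda>S. \<forall>i<N. S $$ (i, cyc_next N i) \<noteq> 0)"
  unfolding for_generic_def
proof (intro exI conjI ballI impI)
  let ?f = "\<lambda>S :: complex mat. \<Prod>i<N. S $$ (i, cyc_next N i)"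
  show "matrix_polynomial N ?f"
    using cyc_simps[OF assms] by (intro matrix_polynomial_prod matrix_polynomial.entry) auto
  let ?J = "mat N N (\<lambda>_. 1) :: complex mat"
  show "\<exists>S\<in>sym_mats N. ?f S \<noteq> 0"
    using cyc_simps[OF assms] by (intro bexI[of _ ?J]) (auto simp: sym_mats_iff)
  show "?f S \<noteq> 0 \<Longrightarrow> \<forall>i<N. S $$ (i, cyc_next N i) \<noteq> 0" for S by simp
qed

text \<open>The identity matrix need not be generic, but the line from it to a generic
  \<open>S1\<close> meets the exceptional locus only finitely often. For small nonzero
  \<open>t\<close> the fibre therefore has exactly \<open>d\<close> points, among them one near each
  limit.\<close>

theorem cycle_degree_ge:
  assumes N: "N \<ge> 4" and deg: "has_ML_degree N (cycle_graph N) d"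
  shows "1 + (N - 3) * 2 ^ (N - 2) \<le> d"
proof -
  have N3: "N \<ge> 3" using N by simp
  let ?F = "\<lambda>S. {S + A | A. A \<in> L_perp N (cycle_graph N)} \<inter> L_inv N (cycle_graph N)"
  obtain f S0 where f: "matrix_polynomial N f" "S0 \<in> sym_mats N" "f S0 \<noteq> 0"
    and fibre: "\<And>S. S \<in> sym_mats N \<Longrightarrow> f S \<noteq> 0 \<Longrightarrow> finite (?F S) \<and> card (?F S) = d"
    using deg unfolding has_ML_degree_def for_generic_def by blast
  have "for_generic N (\<lambda>S. f S \<noteq> 0)" unfolding for_generic_def using f by blast
  then obtain S1 where S1: "S1 \<in> sym_mats N" "f S1 \<noteq> 0" "\<And>i. i < N \<Longrightarrow> S1 $$ (i, cyc_next N i) \<noteq> 0"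
    using for_generic_conj[OF _ for_generic_edges_nonzero[OF N3]] by blast
  have S1c: "S1 \<in> carrier_mat N N" and S1s: "\<And>i j. i < N \<Longrightarrow> j < N \<Longrightarrow> S1 $$ (i, j) = S1 $$ (j, i)"
    using S1(1) by (auto simp: sym_mats_iff)
  define \<delta> :: "nat \<Rightarrow> nat \<Rightarrow> complex" where "\<delta> i j = (if i = j then 1 else 0)" for i j
  define S where "S t = mat N N (\<lambda>(i, j). \<delta> i j + t * (S1 $$ (i, j) - \<delta> i j))" for t
  define b where "b i = S1 $$ (i, i) - 1" for i
  define c where "c i = S1 $$ (i, cyc_next N i)" for i
  have S: "S t \<in> sym_mats N" for t using S1s by (auto simp: sym_mats_iff S_def \<delta>_def)
  have diag: "S t $$ (i, i) = 1 + t * b i" if "i < N" for i t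
    using that by (simp add: S_def \<delta>_def b_def)
  have path: "S t $$ (i, Suc i) = t * c i" if "Suc i < N" for i t
    using that by (simp add: S_def \<delta>_def c_def cyc_next_def)
  have closing: "S t $$ (0, N - 1) = t * c (N - 1)" for t
    using N S1s[of 0 "N - 1"] by (simp add: S_def \<delta>_def c_def cyc_next_def)
  have c: "c i \<noteq> 0" if "i < N" for i using S1(3)[OF that] by (simp add: c_def)
  obtain p where p: "\<And>t. f (S t) = poly p t"
    using matrix_polynomial_on_line[OF f(1), of \<delta> "\<lambda>i j. S1 $$ (i, j) - \<delta> i j"] unfolding S_def by blast
  have "S 1 = S1" using S1c by (auto simp: S_def intro!: eq_matI)
  then have "p \<noteq> 0" using p[of 1] S1(2) by auto
  then have "\<forall>\<^sub>F t in at 0. t \<notin> {t. poly p t = 0}"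
    by (intro eventually_at_not_in_finite poly_roots_finite)
  then have card: "\<forall>\<^sub>F t in at 0. finite (?F (S t)) \<and> card (?F (S t)) = d"
  proof eventually_elim
    case (elim t)
    then show ?case using fibre[OF S, of t] by (simp add: p)
  qed
  \<comment> \<open>The \<open>2 * (N - 2)\<close>-th roots of unity in the open upper half plane,
    one from each pair \<open>z\<close>, \<open>1 / z\<close>.\<close>
  define \<theta> where "\<theta> k = pi * real k / real (N - 2)" for k
  define K where "K = {1..N - 3}"
  have \<theta>: "0 < \<theta> k" "\<theta> k < pi" if "k \<in> K" for k
    using that N by (auto simp: K_def \<theta>_def divide_simps)
  have z: "cis (\<theta> k) ^ (2 * (N - 2)) = 1" "(cis (\<theta> k))\<^sup>2 \<noteq> 1" if "k \<in> K" for k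
  proof -
    have "real (2 * M) * (pi * real k / real M) = 2 * pi * real k" if "M > 0" for M using that by simp
    from this[of "N - 2"] have "real (2 * (N - 2)) * \<theta> k = 2 * pi * real k"
      using N unfolding \<theta>_def by simp
    then show "cis (\<theta> k) ^ (2 * (N - 2)) = 1" by (simp only: Complex.DeMoivre) (simp add: cis_multiple_2pi)
    have "sin (\<theta> k) \<noteq> 0" using sin_gt_zero[OF \<theta>[OF that]] by simp
    then have "cis (\<theta> k) \<noteq> 1" "cis (\<theta> k) \<noteq> - 1"
      by (auto simp: complex_eq_iff)
    then show "(cis (\<theta> k))\<^sup>2 \<noteq> 1" by (simp add: power2_eq_1_iff)
  qed
  \<comment> \<open>\<open>None\<close> stands for the identity matrix; leaving the edge 0 out of
    \<open>T\<close> normalises its sign.\<close>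
  define I where "I = insert None (Some ` (K \<times> Pow {1..<N - 1}))"
  define \<phi> where "\<phi> x i j = (case x of None \<Rightarrow> \<delta> i j | Some (k, T) \<Rightarrow> limit_entry (cis (\<theta> k)) T i j)" for x i j
  have "card I = Suc (card (Some ` (K \<times> Pow {1..<N - 1})))"
    unfolding I_def by (rule card_insert_disjoint) (auto simp: K_def)
  also have "card (Some ` (K \<times> Pow {1..<N - 1})) = (N - 3) * 2 ^ (N - 2)"
    using N by (simp add: card_image card_cartesian_product card_Pow K_def)
  finally have "card I = 1 + (N - 3) * 2 ^ (N - 2)" by simp
  moreover have "card I \<le> d"
  proof (rule card_le_of_perturbation[OF _ _ _ card])
    show "finite I" by (simp add: I_def K_def)
    show "\<forall>\<^sub>F t in at 0. \<exists>X \<in> ?F (S t). \<forall>i j. i \<le> j \<and> j < N \<longrightarrow> norm (X $$ (i, j) - \<phi> x i j) < \<eta>"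
      if x: "x \<in> I" and \<eta>: "\<eta> > 0" for x \<eta>
    proof (cases x)
      case None
      then show ?thesis
        using fibre_near_identity[OF N3 S diag path closing c \<eta>] by (simp add: \<phi>_def \<delta>_def)
    next
      case (Some y)
      then obtain k T where y: "x = Some (k, T)" "k \<in> K" using x by (auto simp: I_def)
      have "(sgn_of T i)\<^sup>2 = 1" for i by (simp add: sgn_of_def)
      from fibre_near_root_of_unity[OF N3 S diag path closing this z[OF y(2)] \<eta>]
      show ?thesis by (simp add: y(1) \<phi>_def limit_entry_def)
    qed
    show "\<exists>i j. i \<le> j \<and> j < N \<and> \<phi> x i j \<noteq> \<phi> x' i j" if "x \<in> I" "x' \<in> I" "x \<noteq> x'" for x x'
    proof -
      \<comment> \<open>The entry at (0, 2) is 0 for the identity and 1 or -1 for every other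
        limit.\<close>
      have None: "\<phi> None 0 2 \<noteq> \<phi> (Some (k, T)) 0 2" if "k \<in> K" for k T
        using limit_entry_2[OF z(2)[OF that] cis_neq_zero, of T 0]
        by (simp add: \<phi>_def \<delta>_def sgn_of_def numeral_2_eq_2)
      have Some: "\<exists>i j. i \<le> j \<and> j < N \<and> \<phi> (Some (k, T)) i j \<noteq> \<phi> (Some (k', T')) i j"
        if k: "k \<in> K" "k' \<in> K" and T: "T \<subseteq> {1..<N - 1}" "T' \<subseteq> {1..<N - 1}"
          and neq: "(k, T) \<noteq> (k', T')" for k k' T T'
      proof (rule ccontr)
        assume "\<not> ?thesis"
        then have "T = T' \<and> cis (\<theta> k) + inverse (cis (\<theta> k)) = cis (\<theta> k') + inverse (cis (\<theta> k'))"
          using k z(2) T by (intro limit_entry_inj[OF N]) (auto simp: \<phi>_def)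
        \<comment> \<open>On the unit circle \<open>z + 1 / z\<close> is
          \<open>2 * cos (\<theta> k)\<close>, and cosine is injective between 0 and
          \<open>pi\<close>.\<close>
        then have "T = T'" "cos (\<theta> k) = cos (\<theta> k')" by (auto simp: complex_eq_iff)
        moreover from this have "\<theta> k = \<theta> k'"
          using \<theta>[OF k(1)] \<theta>[OF k(2)] by (auto intro: cos_inj_pi[of "\<theta> k" "\<theta> k'"])
        then have "k = k'" using N by (simp add: \<theta>_def)
        ultimately show False using neq by simp
      qed
      show ?thesis
      proof (cases "x = None \<or> x' = None")
        case True
        then show ?thesis using None that N
          by (intro exI[of _ 0] exI[of _ 2]) (auto simp: I_def neq_commute dest: not_sym)
      next
        case False
        then show ?thesis using Some that by (auto simp: I_def)
      qed
    qed
  qed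
  ultimately show ?thesis by simp
qed

theorem proposition3p12:
  shows
   "(\<forall>n d :: nat. n \<ge> 2 \<and> has_ML_degree (2 * n + 1) (cycle_graph (2 * n + 1)) d \<longrightarrow>
       d \<ge> 1 + 2 ^ (2 * n) * card {x :: complex. P (int n - 1) x + x * P (int n - 2) x = 0})
  \<and> (\<forall>n d :: nat. n \<ge> 2 \<and> has_ML_degree (2 * n) (cycle_graph (2 * n)) d \<longrightarrow>
       d \<ge> 1 + 2 ^ (2 * n - 2) * card {x :: complex. P (int n - 1) x - x\<^sup>2 * P (int n - 3) x = 0}
             + 2 ^ (2 * n - 2) * card {x :: complex. P (int n - 2) x = 0}
             + 2 ^ (2 * n - 2))
  \<and> (\<forall>n d :: nat. n \<ge> 4 \<and> has_ML_degree n (cycle_graph n) d \<longrightarrow> d > 1)"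
proof (intro conjI allI impI; elim conjE)
  fix n d :: nat
  assume n: "n \<ge> 2" and deg: "has_ML_degree (2 * n + 1) (cycle_graph (2 * n + 1)) d"
  let ?k = "card {x :: complex. P (int n - 1) x + x * P (int n - 2) x = 0}"
  \<comment> \<open>With \<open>N = 2 * n + 1\<close> the factor \<open>N - 3 = 2 * (n - 1)\<close>
    absorbs one power of 2.\<close>
  have "2 ^ (2 * n) * ?k \<le> 2 ^ (2 * n) * (n - 1)" using card_roots_odd[OF n] by simp
  also have "\<dots> = (2 * n + 1 - 3) * 2 ^ (2 * n + 1 - 2)"
  proof -
    obtain m where "n = Suc m" using n by (cases n) auto
    then show ?thesis by simp
  qed
  finally show "d \<ge> 1 + 2 ^ (2 * n) * ?k" using cycle_degree_ge[OF _ deg] n by linarith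
next
  fix n d :: nat
  assume n: "n \<ge> 2" and deg: "has_ML_degree (2 * n) (cycle_graph (2 * n)) d"
  let ?k = "card {x :: complex. P (int n - 1) x - x\<^sup>2 * P (int n - 3) x = 0}"
  let ?l = "card {x :: complex. P (int n - 2) x = 0}"
  have "2 ^ (2 * n - 2) * ?k + 2 ^ (2 * n - 2) * ?l + 2 ^ (2 * n - 2) = 2 ^ (2 * n - 2) * (?k + ?l + 1)"
    by (simp add: distrib_left)
  \<comment> \<open>The two root counts add up to at most \<open>2 * n - 4\<close>, and the extra 1
    completes \<open>N - 3\<close>.\<close>
  also have "\<dots> \<le> 2 ^ (2 * n - 2) * (2 * n - 3)"
    using card_roots_even[OF n] n by (intro mult_left_mono) auto
  finally show "d \<ge> 1 + 2 ^ (2 * n - 2) * ?k + 2 ^ (2 * n - 2) * ?l + 2 ^ (2 * n - 2)"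
    using cycle_degree_ge[OF _ deg] n by (simp add: mult.commute)
next
  fix n d :: nat
  assume n: "n \<ge> 4" and deg: "has_ML_degree n (cycle_graph n) d"
  have "0 < (n - 3) * 2 ^ (n - 2)" using n by simp
  then show "d > 1" using cycle_degree_ge[OF n deg] by linarith
qed

end
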